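(* Let $\Omega$ be a domain in $\mathbb{R}^N$, let $K$ be a piecewise smooth surface of codimension $k$ (with the conventions given in the context), let $d(x)=\mathrm{dist}(x,K)$, and let $p=k>1$. Assume that $d$ is bounded in $\Omega$ and that $d\Delta d+1-k\ge 0$ in $\Omega\setminus K$ in the weak sense, i.e. $A[\phi]\ge 0$ for all non-negative $\phi\in C^1_c(\Omega\setminus K)$, where $A[\phi]=-\int_\Omega d\,\nabla d\cdot\nabla\phi\,dx-k\int_\Omega\phi\,dx$. Then for any $D\ge\sup_{x\in\Omega}d(x)$ there holds $$\int_\Omega|\nabla u|^p\,dx\ \ge\ \left(\frac{p-1}{p}\right)^p\int_\Omega\frac{|u|^p}{d^p}X^p(d/D)\,dx,\qquad u\in W^{1,p}_0(\Omega\setminus K).$$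
   Context: $X(t)=-1/\log t$ for $t\in(0,1)$. Conventions on $K$: for $2\le k\le N-1$, $K$ is a piecewise smooth, closed and connected surface of codimension $k$ in $\mathbb{R}^N$; for $k=N$, $K$ is a single point, say the origin, so $d(x)=|x|$. The function $d$ is Lipschitz with $|\nabla d|=1$ a.e. Formally, $A[\phi]=\int_\Omega(d\Delta d+1-k)\phi\,dx$. *)

theory Defs
  imports "HOL-Analysis.Analysis"
begin

subsection \<open>Differentiability classes and test functions\<close>

text \<open>\<open>Ck_on n f S\<close> is meant for open \<open>S\<close> in a finite-dimensional space, where
  it is the usual class \<open>C\<^sup>n(S)\<close>.\<close>

primrec Ck_on :: "nat \<Rightarrow> ('a::euclidean_space \<Rightarrow> 'b::real_normed_vector) \<Rightarrow> 'a set \<Rightarrow> bool" where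
  "Ck_on 0 f S \<longleftrightarrow> continuous_on S f"
| "Ck_on (Suc n) f S \<longleftrightarrow>
     f differentiable_on S \<and> (\<forall>v. Ck_on n (\<lambda>x. frechet_derivative f (at x) v) S)"

definition smooth_on :: "'a set \<Rightarrow> ('a::euclidean_space \<Rightarrow> 'b::real_normed_vector) \<Rightarrow> bool" where
  "smooth_on S f \<longleftrightarrow> (\<forall>n. Ck_on n f S)"

definition compactly_supported_in :: "'a::euclidean_space set \<Rightarrow> ('a \<Rightarrow> real) \<Rightarrow> bool" where
  "compactly_supported_in U f \<longleftrightarrow>
     compact (closure {x. f x \<noteq> 0}) \<and> closure {x. f x \<noteq> 0} \<subseteq> U"

text \<open>Compactly supported functions on \<open>U\<close> are represented by their extensions by zero,
  which are as regular on the whole space as they are on the open set \<open>U\<close>.\<close>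

definition C1c :: "'a::euclidean_space set \<Rightarrow> ('a \<Rightarrow> real) set" where
  "C1c U = {f. Ck_on 1 f UNIV \<and> compactly_supported_in U f}"

definition Cinfc :: "'a::euclidean_space set \<Rightarrow> ('a \<Rightarrow> real) set" where
  "Cinfc U = {f. smooth_on UNIV f \<and> compactly_supported_in U f}"

text \<open>The pointwise gradient, with value \<open>0\<close> where the function is not differentiable; for a
  Lipschitz function, such as a distance function, this is a null set.\<close>

definition grad :: "('a::euclidean_space \<Rightarrow> real) \<Rightarrow> 'a \<Rightarrow> 'a" where
  "grad f x = (if \<exists>D. GDERIV f x :> D then THE D. GDERIV f x :> D else 0)"


subsection \<open>Sobolev spaces on an open set\<close>

text \<open>Elements of these spaces are total functions of which only the values on \<open>U\<close> matter.\<close>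

definition in_Lp :: "real \<Rightarrow> 'a::euclidean_space set \<Rightarrow> ('a \<Rightarrow> 'b::euclidean_space) \<Rightarrow> bool" where
  "in_Lp p U f \<longleftrightarrow> set_borel_measurable lebesgue U f \<and>
     (\<integral>\<^sup>+x\<in>U. ennreal (norm (f x) powr p) \<partial>lebesgue) < \<infinity>"

definition loc_integrable :: "'a::euclidean_space set \<Rightarrow> ('a \<Rightarrow> 'b::euclidean_space) \<Rightarrow> bool" where
  "loc_integrable U f \<longleftrightarrow> (\<forall>C. compact C \<and> C \<subseteq> U \<longrightarrow> set_integrable lebesgue C f)"

definition weak_gradient :: "'a::euclidean_space set \<Rightarrow> ('a \<Rightarrow> real) \<Rightarrow> ('a \<Rightarrow> 'a) \<Rightarrow> bool" where
  "weak_gradient U u G \<longleftrightarrow> loc_integrable U u \<and> loc_integrable U G \<and>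
     (\<forall>\<phi>\<in>Cinfc U. \<forall>b\<in>Basis.
        (LINT x:U|lebesgue. u x * (grad \<phi> x \<bullet> b)) = - (LINT x:U|lebesgue. (G x \<bullet> b) * \<phi> x))"

definition W1p :: "real \<Rightarrow> 'a::euclidean_space set \<Rightarrow> ('a \<Rightarrow> real) set" where
  "W1p p U = {u. in_Lp p U u \<and> (\<exists>G. weak_gradient U u G \<and> in_Lp p U G)}"

text \<open>The closure of \<open>Cinfc U\<close> in the norm of \<open>W1p p U\<close>.\<close>

definition W1p0 :: "real \<Rightarrow> 'a::euclidean_space set \<Rightarrow> ('a \<Rightarrow> real) set" where
  "W1p0 p U = {u \<in> W1p p U. \<exists>G \<phi>. weak_gradient U u G \<and> in_Lp p U G \<and> (\<forall>n::nat. \<phi> n \<in> Cinfc U) \<and>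
     (\<lambda>n. \<integral>\<^sup>+x\<in>U. ennreal (norm (\<phi> n x - u x) powr p) \<partial>lebesgue) \<longlonglongrightarrow> 0 \<and>
     (\<lambda>n. \<integral>\<^sup>+x\<in>U. ennreal (norm (grad (\<phi> n) x - G x) powr p) \<partial>lebesgue) \<longlonglongrightarrow> 0}"


subsection \<open>Piecewise smooth surfaces\<close>

text \<open>\<open>(f, P)\<close> parametrises the \<open>m\<close>-dimensional smooth piece \<open>f ` P\<close>. As usual for piecewise
  smooth surfaces (think of polar coordinates on a sphere or a cone), \<open>f\<close> may degenerate or
  identify points on the relative boundary of the polytope \<open>P\<close>. The parameter space is an
  \<open>m\<close>-dimensional affine subspace of the ambient space, the dimension of a type being fixed;
  its directions are the vectors \<open>v\<close> below.\<close>

definition smooth_piece :: "nat \<Rightarrow> ('a::euclidean_space \<Rightarrow> 'a) \<Rightarrow> 'a set \<Rightarrow> bool" where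
  "smooth_piece m f P \<longleftrightarrow> polytope P \<and> aff_dim P = int m \<and>
     (\<exists>W. open W \<and> P \<subseteq> W \<and> smooth_on W f) \<and>
     (\<forall>x\<in>rel_interior P. \<forall>y\<in>P. f x = f y \<longrightarrow> x = y) \<and>
     (\<forall>x\<in>rel_interior P. \<forall>v. x + v \<in> affine hull P \<and> v \<noteq> 0 \<longrightarrow> frechet_derivative f (at x) v \<noteq> 0)"

text \<open>Locally finitely many smooth pieces which meet only along their boundaries.\<close>

definition piecewise_smooth :: "nat \<Rightarrow> 'a::euclidean_space set \<Rightarrow> bool" where
  "piecewise_smooth m K \<longleftrightarrow> (\<exists>\<F>.
     (\<forall>(f, P)\<in>\<F>. smooth_piece m f P) \<and>
     pairwise (\<lambda>(f, P) (g, Q). f ` rel_interior P \<inter> g ` Q = {}) \<F> \<and>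
     locally_finite_in euclidean ((\<lambda>(f, P). f ` P) ` \<F>) \<and>
     K = (\<Union>(f, P)\<in>\<F>. f ` P))"

text \<open>Here ``closed'' means topologically closed; \<open>K\<close> may be unbounded.\<close>

definition surface_of_codim :: "nat \<Rightarrow> 'a::euclidean_space set \<Rightarrow> bool" where
  "surface_of_codim k K \<longleftrightarrow>
     (if k = DIM('a) then \<exists>a. K = {a}
      else k < DIM('a) \<and> piecewise_smooth (DIM('a) - k) K \<and> K \<noteq> {} \<and> closed K \<and> connected K)"


subsection \<open>The functional and the weight\<close>

text \<open>The weak form of \<open>\<integral>\<^sub>\<Omega> (d \<Delta>d + 1 - k) \<phi> dx\<close>, where \<open>d\<close> is the distance to \<open>K\<close>.\<close>

definition A_fun :: "'a::euclidean_space set \<Rightarrow> 'a set \<Rightarrow> nat \<Rightarrow> ('a \<Rightarrow> real) \<Rightarrow> real" where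
  "A_fun \<Omega> K k \<phi> =
     - (LINT x:\<Omega>|lebesgue. infdist x K * (grad (\<lambda>y. infdist y K) x \<bullet> grad \<phi> x))
     - real k * (LINT x:\<Omega>|lebesgue. \<phi> x)"

text \<open>Only \<open>0 < t < 1\<close> is meaningful; the formula gives \<open>0\<close> at \<open>t = 0\<close> and \<open>t = 1\<close>.\<close>

definition X :: "real \<Rightarrow> real" where
  "X t = - 1 / ln t"

end

theory Submission
  imports Defs
begin

text \<open>Let \<open>d\<close> be the distance to \<open>K\<close>. For a test function \<open>\<phi>\<close>, insert
  \<open>\<psi> = \<bar>\<phi>\<bar>\<^sup>k h(d)\<close> into \<open>A[\<psi>] \<ge> 0\<close>, where \<open>h(t) = 1 / (t\<^sup>k L\<^bsup>k-1\<^esup>)\<close> and \<open>L = ln (D / t)\<close>.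
  Since \<open>t h' + k h = (k - 1) / (t\<^sup>k L\<^sup>k)\<close> and \<open>\<bar>\<nabla>d\<bar> = 1\<close>, writing \<open>c = \<bar>\<phi>\<bar> / (d L)\<close> this gives
  \<open>(k - 1) \<integral> c\<^sup>k \<le> k \<integral> c\<^bsup>k-1\<^esup> \<bar>\<nabla>\<phi>\<bar>\<close>, and Young's inequality with parameter \<open>(k - 1) / k\<close> turns it into
  the claim for \<open>\<phi>\<close>. As \<open>\<psi>\<close> is only Lipschitz, \<open>d\<close> is first replaced in \<open>h(d)\<close> by its averages \<open>d\<^sub>r\<close> over
  balls of radius \<open>r\<close>, which are \<open>C\<^sup>1\<close>; in the limit one only needs \<open>\<nabla>d \<bullet> \<nabla>d\<^sub>r \<rightarrow> 1\<close> almost everywhere.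
  The endpoint value of \<open>D\<close> follows from larger values by Fatou's
  lemma, and general \<open>u\<close> by density, where the given weak gradient has to be identified with the limit
  of the gradients of the approximating functions.\<close>

subsection \<open>The distance function\<close>

text \<open>The obstacle is regularity: admissible functions are \<open>C^1\<close> with compact
  support off \<open>K\<close>, while \<open>d\<close> is Lipschitz and its gradient is controlled
  only almost everywhere. Ball averages suit this, since their gradient is the average of \<nabla>d
  and hence continuous. That gradient enters only through its inner product with \<nabla>d, and at a
  point strictly inside a unit-rate segment a quantitative estimate forces this product to 1; no
  differentiation theorem for averages is involved.

  The power \<open>t^(-k)\<close> in the profile is dictated by \<open>p = k\<close>:
  differentiating it produces a term that cancels the \<open>k h\<close> coming from
  \<open>A\<close>, so only the derivative of the logarithm survives. With Young parameter
  \<open>l\<close> the resulting constant is \<open>(k - 1) (1 - l) l^(k - 1)\<close>; it is largest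
  at \<open>l = (k - 1) / k\<close>, where it equals \<open>l^k\<close>.

  Values of \<open>D\<close> above the supremum come before the endpoint because at the endpoint
  \<open>ln (D / d)\<close> may vanish inside the support of \<phi>, where the profile blows
  up.\<close>

lemma GDERIV_unique:
  fixes f :: "'a::euclidean_space \<Rightarrow> real"
  assumes "GDERIV f x :> a" "GDERIV f x :> b"
  shows "a = b"
proof -
  have "(\<lambda>h. h \<bullet> a) = (\<lambda>h. h \<bullet> b)"
    using assms unfolding gderiv_def by (rule has_derivative_unique)
  then have "h \<bullet> a = h \<bullet> b" for h by meson
  then show ?thesis by (metis inner_commute vector_eq_ldot)
qed

lemma grad_eqI: "GDERIV f x :> a \<Longrightarrow> grad f x = a"
  unfolding grad_def by (auto intro: GDERIV_unique the_equality)

text \<open>The points that lie strictly inside a segment along which the distance to \<open>K\<close> grows at unit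
  rate. There the distance is squeezed between two cones with the same gradient, which replaces
  Rademacher's theorem.\<close>

definition ray_interior :: "'a::euclidean_space set \<Rightarrow> 'a set" where
  "ray_interior K = {x. x \<notin> K \<and> (\<exists>w. w \<noteq> x \<and> infdist w K = infdist x K + dist x w)}"

text \<open>All three functions agree at \<open>x\<close>, so after subtracting the common linear
  part the remainder of \<open>f\<close> lies between two remainders of order o(norm (z -
  x)).\<close>

lemma GDERIV_squeeze:
  fixes f :: "'a::euclidean_space \<Rightarrow> real"
  assumes "GDERIV l x :> a" "GDERIV u x :> a"
    and "\<And>z. l z \<le> f z" "\<And>z. f z \<le> u z" "l x = f x" "u x = f x"
  shows "GDERIV f x :> a"
proof -
  have L: "((\<lambda>z. (l z - l x - (z - x) \<bullet> a) / norm (z - x)) \<longlongrightarrow> 0) (at x)"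
    and U: "((\<lambda>z. (u z - u x - (z - x) \<bullet> a) / norm (z - x)) \<longlongrightarrow> 0) (at x)"
    using assms(1,2) unfolding gderiv_def has_derivative_def
    by (auto simp: divide_inverse_commute algebra_simps netlimit_at)
  have "((\<lambda>z. (f z - f x - (z - x) \<bullet> a) / norm (z - x)) \<longlongrightarrow> 0) (at x)"
    by (rule tendsto_sandwich[OF _ _ L U])
      (use assms(3-6) in \<open>auto intro!: always_eventually divide_right_mono\<close>)
  then show ?thesis
    unfolding gderiv_def has_derivative_def
    by (auto simp: divide_inverse_commute algebra_simps netlimit_at bounded_linear_inner_left)
qed

text \<open>Equality in the triangle inequality through \<open>x\<close> puts \<open>w\<close>,
  \<open>x\<close> and \<open>y\<close> on one line with \<open>x\<close> in between. Hence the cone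
  with vertex \<open>y\<close>, which bounds the distance from above, and the inverted cone with
  vertex \<open>w\<close>, which bounds it from below, have the same gradient at
  \<open>x\<close>.\<close>

lemma nearest_gradient:
  fixes K :: "'a::euclidean_space set"
  assumes K: "closed K" "K \<noteq> {}" and x: "x \<notin> K"
    and w: "w \<noteq> x" "infdist w K = infdist x K + dist x w"
    and y: "y \<in> K" "infdist x K = dist x y"
  shows "w - x = (norm (w - x) / norm (x - y)) *\<^sub>R (x - y)"
    and "GDERIV (\<lambda>z. infdist z K) x :> sgn (x - y)"
proof -
  have "x \<noteq> y" using x y by auto
  have "dist w y \<le> dist w x + dist x y" by (rule dist_triangle)
  moreover have "infdist w K \<le> dist w y" using y by (intro infdist_le)
  ultimately have "dist w y = dist w x + dist x y" using w(2) y(2) by (simp add: dist_commute)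
  then have "norm ((w - x) + (x - y)) = norm (w - x) + norm (x - y)"
    by (simp add: dist_norm)
  then have "norm (w - x) *\<^sub>R (x - y) = norm (x - y) *\<^sub>R (w - x)"
    by (simp only: norm_triangle_eq)
  then show 1: "w - x = (norm (w - x) / norm (x - y)) *\<^sub>R (x - y)"
    using \<open>x \<noteq> y\<close>
    by (metis divide_inverse_commute right_minus_eq norm_eq_zero scaleR_scaleR scaleR_one left_inverse)
  have "sgn (w - x) = sgn (x - y)"
    using \<open>w \<noteq> x\<close> \<open>x \<noteq> y\<close> by (subst 1) (simp add: sgn_scaleR)
  moreover have "sgn (x - w) = - sgn (w - x)"
    by (metis minus_diff_eq sgn_minus)
  ultimately have e: "- sgn (x - w) = sgn (x - y)" by simp
  have s: "GDERIV (\<lambda>z. norm (z - c)) x :> sgn (x - c)" if "x \<noteq> c" for c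
  proof -
    have "((\<lambda>z. z - c) has_derivative (\<lambda>h. h)) (at x)"
      by (auto intro!: derivative_eq_intros)
    from has_derivative_compose[OF this has_derivative_norm] that
    show ?thesis by (simp add: gderiv_def)
  qed
  show "GDERIV (\<lambda>z. infdist z K) x :> sgn (x - y)"
  proof (rule GDERIV_squeeze)
    have "GDERIV (\<lambda>z. infdist w K - norm (z - w)) x :> 0 - sgn (x - w)"
      by (intro GDERIV_diff GDERIV_const s) (use w in auto)
    then show "GDERIV (\<lambda>z. infdist w K - norm (z - w)) x :> sgn (x - y)" using e by simp
    show "GDERIV (\<lambda>z. norm (z - y)) x :> sgn (x - y)" by (rule s) fact
    show "infdist z K \<le> norm (z - y)" for z using y infdist_le[of y K z] by (simp add: dist_norm)
    show "infdist w K - norm (z - w) \<le> infdist z K" for z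
      using infdist_triangle[of w K z] by (simp add: dist_norm norm_minus_commute)
    show "norm (x - y) = infdist x K" using y by (simp add: dist_norm)
    show "infdist w K - norm (x - w) = infdist x K"
      using w by (simp add: dist_norm norm_minus_commute)
  qed
qed

lemma ray_interior_gradient:
  fixes K :: "'a::euclidean_space set"
  assumes K: "closed K" "K \<noteq> {}" and x: "x \<in> ray_interior K"
  obtains e where "norm e = 1" "GDERIV (\<lambda>z. infdist z K) x :> e"
proof -
  obtain y where y: "y \<in> K" "infdist x K = dist x y" using infdist_attains_inf[OF K] by blast
  have "x \<noteq> y" using x y by (auto simp: ray_interior_def)
  then have "norm (sgn (x - y)) = 1" by (simp add: norm_sgn)
  with nearest_gradient[OF K _ _ _ y] x that show ?thesis by (auto simp: ray_interior_def)
qed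

text \<open>A quantitative form of the continuity of the gradient at a point of \<open>ray_interior K\<close>; it comes
  from comparing the squared distance with the squared distance to one nearest point.\<close>

lemma ray_interior_inner_gradients:
  fixes K :: "'a::euclidean_space set"
  assumes K: "closed K" "K \<noteq> {}" and z: "z \<in> ray_interior K" and x: "x \<notin> K"
    and w: "w \<noteq> x" "infdist w K = infdist x K + dist x w"
    and r: "dist z x \<le> r" and r2: "2 * r \<le> dist x w"
  shows "grad (\<lambda>y. infdist y K) x \<bullet> grad (\<lambda>y. infdist y K) z
    \<ge> 1 - 2 * r / dist x w - 2 * r / infdist z K"
proof -
  let ?d = "\<lambda>z. infdist z K"
  obtain y where y: "y \<in> K" "?d x = dist x y" using infdist_attains_inf[OF K] by blast
  obtain y' where y': "y' \<in> K" "?d z = dist z y'" using infdist_attains_inf[OF K] by blast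
  define e where "e = sgn (x - y)"
  define e' where "e' = sgn (z - y')"
  define s where "s = dist x w"
  have "x \<noteq> y" using x y by auto
  have zK: "z \<notin> K" using z by (auto simp: ray_interior_def)
  then have dz: "?d z > 0" using K by (simp add: infdist_pos_not_in_closed)
  have s0: "s > 0" using w by (simp add: s_def)
  have w_eq: "w = x + s *\<^sub>R e"
  proof -
    have "w - x = (norm (w - x) / norm (x - y)) *\<^sub>R (x - y)"
      by (rule nearest_gradient(1)[OF K x w y])
    also have "\<dots> = s *\<^sub>R e"
      by (simp add: s_def e_def sgn_div_norm dist_norm norm_minus_commute divide_inverse_commute mult.commute)
    finally show ?thesis by (simp add: algebra_simps)
  qed
  have ge: "grad ?d x = e"
    using grad_eqI[OF nearest_gradient(2)[OF K x w y]] by (simp add: e_def)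
  have ge': "grad ?d z = e'"
    using z grad_eqI[OF nearest_gradient(2)[OF K zK _ _ y']] by (auto simp: ray_interior_def e'_def)
  have ne: "norm e = 1" using \<open>x \<noteq> y\<close> by (simp add: e_def norm_sgn)
  have zy: "z - y' = ?d z *\<^sub>R e'"
    using dz y' by (simp add: e'_def sgn_div_norm dist_norm)
  have "?d (z + s *\<^sub>R e) \<le> norm ((z - y') + s *\<^sub>R e)"
    using infdist_le[OF y'(1), of "z + s *\<^sub>R e"] by (simp add: dist_norm algebra_simps)
  then have "(?d (z + s *\<^sub>R e))\<^sup>2 \<le> (norm ((z - y') + s *\<^sub>R e))\<^sup>2"
    by (intro power_mono) (auto simp: infdist_nonneg)
  also have "\<dots> = (?d z)\<^sup>2 + 2 * (s * ?d z * (e' \<bullet> e)) + s\<^sup>2"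
  proof -
    have "(norm (z - y'))\<^sup>2 = (?d z)\<^sup>2" using y' by (simp add: dist_norm)
    moreover have "(z - y') \<bullet> (s *\<^sub>R e) = s * ?d z * (e' \<bullet> e)" by (simp add: zy)
    moreover have "(norm (s *\<^sub>R e))\<^sup>2 = s\<^sup>2" by (simp add: ne)
    ultimately show ?thesis by (simp only: power2_norm_eq_inner inner_add_left inner_add_right)
      (simp add: inner_commute)
  qed
  finally have 1: "(?d (z + s *\<^sub>R e))\<^sup>2 \<le> (?d z)\<^sup>2 + 2 * (s * ?d z * (e' \<bullet> e)) + s\<^sup>2" .
  \<comment> \<open>The loss \<open>2 * r\<close> has two sources: shifting the far endpoint from
    \<open>w\<close> to \<open>z + s *\<^sub>R e\<close> costs \<open>dist z x\<close>, and
    replacing \<open>infdist x K\<close> by \<open>infdist z K\<close> costs the same again. Because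
    \<open>2 * r \<le> dist x w\<close>, the lower bound is nonnegative and may be squared.\<close>
  have "?d w \<le> ?d (z + s *\<^sub>R e) + dist w (z + s *\<^sub>R e)" by (rule infdist_triangle)
  moreover have "dist w (z + s *\<^sub>R e) = dist z x" by (simp add: w_eq dist_norm norm_minus_commute)
  moreover have "?d z \<le> ?d x + dist z x" by (rule infdist_triangle)
  ultimately have "?d z + (s - 2 * r) \<le> ?d (z + s *\<^sub>R e)"
    using w(2) r unfolding s_def[symmetric] by linarith
  then have "(?d z + (s - 2 * r))\<^sup>2 \<le> (?d (z + s *\<^sub>R e))\<^sup>2"
    using dz r2 by (intro power_mono) (auto simp: s_def)
  with 1 have "(?d z + (s - 2 * r))\<^sup>2 \<le> (?d z)\<^sup>2 + 2 * (s * ?d z * (e' \<bullet> e)) + s\<^sup>2" by linarith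
  then have "2 * (s * ?d z) * (1 - (e' \<bullet> e)) \<le> 4 * r * ?d z + 4 * r * s - 4 * r\<^sup>2"
    by (simp add: power2_eq_square algebra_simps)
  also have "\<dots> \<le> 4 * r * ?d z + 4 * r * s" by simp
  finally have "1 - (e' \<bullet> e) \<le> (4 * r * ?d z + 4 * r * s) / (2 * (s * ?d z))"
    using s0 dz by (simp add: pos_le_divide_eq mult.commute)
  also have "\<dots> = 2 * r / s + 2 * r / ?d z"
    using s0 dz by (simp add: field_simps)
  finally show ?thesis by (simp add: ge ge' s_def inner_commute)
qed

section \<open>Measurability of \<open>ray_interior K\<close> and negligibility of its complement
  off \<open>K\<close>\<close>

lemma closed_reach:
  fixes K :: "'a::euclidean_space set"
  shows "closed {x. \<exists>v\<in>sphere 0 r. infdist (x + v) K = infdist x K + r}"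
  unfolding closed_sequential_limits
proof (intro allI impI)
  fix f :: "nat \<Rightarrow> 'a" and x
  assume "(\<forall>n. f n \<in> {x. \<exists>v\<in>sphere 0 r. infdist (x + v) K = infdist x K + r}) \<and> f \<longlonglongrightarrow> x"
  then have f: "\<forall>n. \<exists>v. norm v = r \<and> infdist (f n + v) K = infdist (f n) K + r"
    and lim: "f \<longlonglongrightarrow> x" by force+
  obtain v where v: "\<And>n. norm (v n) = r" "\<And>n. infdist (f n + v n) K = infdist (f n) K + r"
    using f by metis
  have "\<forall>n. v n \<in> sphere 0 r" using v by simp
  \<comment> \<open>The direction depends on the point of the sequence; compactness of the sphere
    supplies a limit direction.\<close>
  then obtain l s where l: "l \<in> sphere 0 r" "strict_mono s" "(v \<circ> s) \<longlonglongrightarrow> l"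
    using compact_sphere[of 0 r] unfolding compact_def by meson
  have fs: "(\<lambda>n. f (s n)) \<longlonglongrightarrow> x"
    using LIMSEQ_subseq_LIMSEQ[OF lim l(2)] by (simp add: o_def)
  have "(\<lambda>n. infdist (f (s n) + v (s n)) K) \<longlonglongrightarrow> infdist (x + l) K"
    using fs l(3) by (intro tendsto_intros) (auto simp: o_def)
  moreover have "(\<lambda>n. infdist (f (s n)) K + r) \<longlonglongrightarrow> infdist x K + r"
    using fs by (intro tendsto_intros)
  ultimately have "infdist (x + l) K = infdist x K + r"
    using v(2) by (simp add: LIMSEQ_unique)
  with l(1) show "x \<in> {x. \<exists>v\<in>sphere 0 r. infdist (x + v) K = infdist x K + r}" by auto
qed

text \<open>The distance is 1-Lipschitz, so unit-rate growth over the whole segment to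
  \<open>w\<close> forces it on every initial piece, and the lengths \<open>inverse (Suc n)\<close>
  suffice. For each of them the set is closed, which makes \<open>ray_interior K\<close> Borel for
  closed \<open>K\<close>.\<close>

lemma ray_interior_eq:
  fixes K :: "'a::euclidean_space set"
  shows "ray_interior K = (\<Union>n. {x. \<exists>v\<in>sphere 0 (inverse (Suc n)). infdist (x + v) K = infdist x K + inverse (Suc n)}) - K"
proof (intro equalityI subsetI)
  fix x assume "x \<in> ray_interior K"
  then obtain w where w: "x \<notin> K" "w \<noteq> x" "infdist w K = infdist x K + dist x w"
    by (auto simp: ray_interior_def)
  obtain n where n: "inverse (real (Suc n)) < dist x w"
    using w(2) reals_Archimedean[of "dist x w"] by auto
  define r where "r = inverse (real (Suc n))"
  define v where "v = (r / dist x w) *\<^sub>R (w - x)"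
  have r: "0 < r" "r < dist x w" using n by (auto simp: r_def)
  have nv: "norm v = r" using w r by (simp add: v_def dist_norm norm_minus_commute)
  have "w - (x + v) = (1 - r / dist x w) *\<^sub>R (w - x)"
    by (simp add: v_def algebra_simps)
  then have "dist w (x + v) = (1 - r / dist x w) * dist x w"
    using r by (simp add: dist_norm norm_minus_commute divide_le_eq)
  also have "\<dots> = dist x w - r" using r w(2) by (simp add: field_simps)
  finally have "infdist x K + r \<le> infdist (x + v) K"
    using infdist_triangle[of w K "x + v"] w by simp
  moreover have "infdist (x + v) K \<le> infdist x K + r"
    using infdist_triangle[of "x + v" K x] nv by (simp add: dist_norm)
  ultimately have "infdist (x + v) K = infdist x K + r" by simp
  with nv w(1)
  show "x \<in> (\<Union>n. {x. \<exists>v\<in>sphere 0 (inverse (Suc n)). infdist (x + v) K = infdist x K + inverse (Suc n)}) - K"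
    unfolding r_def mem_sphere_0[symmetric] by blast
next
  fix x
  assume "x \<in> (\<Union>n. {x. \<exists>v\<in>sphere 0 (inverse (Suc n)). infdist (x + v) K = infdist x K + inverse (Suc n)}) - K"
  then obtain n v where v: "norm v = inverse (Suc n)" "infdist (x + v) K = infdist x K + inverse (Suc n)" "x \<notin> K"
    by auto
  then have "v \<noteq> 0" by auto
  then show "x \<in> ray_interior K" unfolding ray_interior_def
    using v by (auto intro!: exI[of _ "x + v"] simp: dist_norm)
qed

text \<open>The inverse of \<open>P\<close> on its image is \<open>L\<close>-Lipschitz, whereas
  \<open>P\<close> will be built from a choice of nearest points and may be discontinuous. So the
  covering is done on the image side: Vitali's lemma gives disjoint balls inside \<open>V\<close>
  whose five-fold enlargements cover the image, and pulled back these become balls of radius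
  \<open>5 * L * r i\<close> around the points of \<open>J\<close> that cover
  \<open>C\<close>.\<close>

lemma measure_le_expansive_image:
  fixes C V :: "'a::euclidean_space set" and P :: "'a \<Rightarrow> 'a"
  assumes V: "open V" "V \<in> lmeasurable" and PV: "P ` C \<subseteq> V" and L: "L > 0"
    and P: "\<And>x y. x \<in> C \<Longrightarrow> y \<in> C \<Longrightarrow> dist x y \<le> L * dist (P x) (P y)"
    and C: "C \<in> lmeasurable"
  shows "measure lebesgue C \<le> (5 * L) ^ DIM('a) * measure lebesgue V"
proof -
  \<comment> \<open>The bound 1 on the radii is arbitrary; Vitali's lemma asks for some uniform
    bound.\<close>
  have "\<exists>r. 0 < r \<and> r \<le> 1 \<and> cball (P c) r \<subseteq> V" if "c \<in> C" for c
  proof -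
    obtain e where "e > 0" "cball (P c) e \<subseteq> V"
      using V(1) PV \<open>c \<in> C\<close> unfolding open_contains_cball by blast
    then show ?thesis by (intro exI[of _ "min e 1"]) auto
  qed
  then obtain r where r: "\<And>c. c \<in> C \<Longrightarrow> 0 < r c \<and> r c \<le> 1 \<and> cball (P c) (r c) \<subseteq> V"
    by metis
  have sub: "P ` C \<subseteq> (\<Union>c\<in>C. cball (P c) (r c))"
  proof (intro image_subsetI UN_I)
    show "P c \<in> cball (P c) (r c)" if "c \<in> C" for c using r[OF that] by simp
  qed
  obtain J where J: "countable J" "J \<subseteq> C"
    "pairwise (\<lambda>i j. disjnt (cball (P i) (r i)) (cball (P j) (r j))) J"
    "P ` C \<subseteq> (\<Union>i\<in>J. cball (P i) (5 * r i))"
  proof (rule Vitali_covering_lemma_cballs[OF sub, of 1])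
    show "0 < r c \<and> r c \<le> 1" if "c \<in> C" for c using r[OF that] by simp
  qed
  have cov: "C \<subseteq> (\<Union>i\<in>J. cball i (5 * L * r i))"
  proof
    fix x assume "x \<in> C"
    then have "P x \<in> (\<Union>i\<in>J. cball (P i) (5 * r i))" using J(4) by blast
    then obtain i where i: "i \<in> J" "dist (P i) (P x) \<le> 5 * r i" by auto
    then have "dist i x \<le> L * dist (P i) (P x)" using P[of i x] J(2) i(1) \<open>x \<in> C\<close> by blast
    also have "\<dots> \<le> L * (5 * r i)" using i(2) L by simp
    finally have "x \<in> cball i (5 * L * r i)" by (simp add: ac_simps)
    then show "x \<in> (\<Union>i\<in>J. cball i (5 * L * r i))" using i(1) by blast
  qed
  have fin: "(\<Sum>i\<in>I. measure lebesgue (cball i (5 * L * r i))) \<le> (5 * L) ^ DIM('a) * measure lebesgue V"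
    if "I \<subseteq> J" "finite I" for I
  proof -
    have "(\<Sum>i\<in>I. measure lebesgue (cball i (5 * L * r i)))
        = (\<Sum>i\<in>I. (5 * L) ^ DIM('a) * measure lebesgue (cball (P i) (r i)))"
    proof (rule sum.cong[OF refl])
      fix i assume "i \<in> I"
      then have "r i > 0" using r[of i] J(2) that by blast
      then show "measure lebesgue (cball i (5 * L * r i)) = (5 * L) ^ DIM('a) * measure lebesgue (cball (P i) (r i))"
        using L by (simp add: content_cball power_mult_distrib)
    qed
    also have "\<dots> = (5 * L) ^ DIM('a) * measure lebesgue (\<Union>i\<in>I. cball (P i) (r i))"
      using that pairwise_subset[OF J(3)]
      by (subst measure_UNION') (simp_all add: sum_distrib_left)
    also have "\<dots> \<le> (5 * L) ^ DIM('a) * measure lebesgue V"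
    proof (rule mult_left_mono)
      have "(\<Union>i\<in>I. cball (P i) (r i)) \<subseteq> V"
      proof (rule UN_least)
        show "cball (P i) (r i) \<subseteq> V" if "i \<in> I" for i
          using r[of i] J(2) that \<open>I \<subseteq> J\<close> by auto
      qed
      then show "measure lebesgue (\<Union>i\<in>I. cball (P i) (r i)) \<le> measure lebesgue V"
        using V(2) that by (intro measure_mono_fmeasurable) (auto intro!: fmeasurableD)
    qed (use L in auto)
    finally show ?thesis .
  qed
  have b: "measure lebesgue (\<Union>i\<in>I. cball i (5 * L * r i)) \<le> (5 * L) ^ DIM('a) * measure lebesgue V"
    if "I \<subseteq> J" "finite I" for I
    using measure_UNION_le[of I "\<lambda>i. cball i (5 * L * r i)" lebesgue] fin[OF that] that(2) by force
  have "measure lebesgue C \<le> measure lebesgue (\<Union>i\<in>J. cball i (5 * L * r i))"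
  proof (rule measure_mono_fmeasurable[OF cov])
    show "C \<in> sets lebesgue" using C by (rule fmeasurableD)
    show "(\<Union>i\<in>J. cball i (5 * L * r i)) \<in> lmeasurable"
      by (rule fmeasurable_UN_bound[OF J(1) lmeasurable_cball b])
  qed
  also have "\<dots> \<le> (5 * L) ^ DIM('a) * measure lebesgue V"
    by (rule measure_UN_bound[OF J(1) lmeasurable_cball b])
  finally show ?thesis .
qed

text \<open>Moving a point by the fraction \<open>t\<close> of the way towards a nearest point of \<open>K\<close> maps the complement
  of \<open>K\<close> into \<open>ray_interior K\<close>, and since the choice of nearest points is monotone, it shrinks no distance by more
  than the factor \<open>1 - t\<close>. So it maps a compact subset \<open>C\<close> of the exceptional set into \<open>U - C\<close> for any
  open \<open>U\<close> around \<open>C\<close> once \<open>t\<close> is small, and \<open>U - C\<close> may have arbitrarily small measure.\<close>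

lemma negligible_compl_ray_interior:
  fixes K :: "'a::euclidean_space set"
  assumes K: "closed K" "K \<noteq> {}"
  shows "negligible (- K - ray_interior K)"
proof -
  have "ray_interior K \<in> sets lebesgue"
    unfolding ray_interior_eq using closed_reach[of _ K] K by (intro sets.Diff sets.countable_UN) auto
  then have "- K - ray_interior K \<in> sets lebesgue" using K by (auto intro!: sets.Diff)
  then obtain N C where N: "negligible N" "\<And>n::nat. compact (C n)" "- K - ray_interior K = (\<Union>n. C n) \<union> N"
    using lebesgue_regular_inner by meson
  have "negligible C" if "compact C" "C \<subseteq> - K - ray_interior K" for C
  proof (cases "C = {}")
    case False
    have Cm: "C \<in> lmeasurable" using that by (simp add: lmeasurable_compact)
    have "\<exists>y. y \<in> K \<and> infdist x K = dist x y" for x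
      using infdist_attains_inf[OF K] by blast
    then obtain y where y: "\<And>x. y x \<in> K \<and> infdist x K = dist x (y x)" by metis
    have small: "measure lebesgue C \<le> 10 ^ DIM('a) * e" if "e > 0" for e
    proof -
      obtain U where U: "open U" "C \<subseteq> U" "U - C \<in> lmeasurable" "emeasure lebesgue (U - C) < ennreal e"
        using sets_lebesgue_outer_open[of C e] Cm \<open>e > 0\<close> by auto
      obtain \<delta> where \<delta>: "\<delta> > 0" "{x. infdist x C \<le> \<delta>} \<subseteq> U"
        using compact_in_open_separated[OF False \<open>compact C\<close> U(1,2)] by blast
      obtain M where M: "\<And>x. x \<in> C \<Longrightarrow> infdist x K \<le> M"
        using compact_continuous_image[of C "\<lambda>x. infdist x K"] \<open>compact C\<close>
        using bounded_imp_bdd_above[OF compact_imp_bounded] unfolding bdd_above_def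
        by (force intro: continuous_intros)
      \<comment> \<open>The bound \<open>1/2\<close> keeps the expansion constant
        \<open>1 / (1 - t)\<close> at most 2, which leads to the factor \<open>5 * 2 = 10\<close>.
        The other bound keeps the displacement \<open>t * infdist x K\<close> within \<delta> on
        \<open>C\<close>, so the image stays in \<open>U\<close>.\<close>
      define t where "t = min (1/2) (\<delta> / (\<bar>M\<bar> + 1))"
      have t: "0 < t" "t \<le> 1/2" using \<delta>(1) by (simp add: t_def) (unfold t_def, rule min.cobounded1)
      have tM: "t * (\<bar>M\<bar> + 1) \<le> \<delta>"
      proof -
        have "t * (\<bar>M\<bar> + 1) \<le> \<delta> / (\<bar>M\<bar> + 1) * (\<bar>M\<bar> + 1)"
          by (intro mult_right_mono) (auto simp: t_def)
        then show ?thesis by simp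
      qed
      define P where "P = (\<lambda>x. x + t *\<^sub>R (y x - x))"
      have dP: "dist x (P x) = t * infdist x K" for x
        using t y[of x] by (simp add: P_def dist_norm norm_minus_commute)
      have "P x \<in> U - C" if "x \<in> C" for x
      proof
        have "infdist (P x) C \<le> dist (P x) x" by (rule infdist_le[OF that])
        also have "\<dots> \<le> t * (\<bar>M\<bar> + 1)"
          using M[OF that] t dP[of x] by (auto simp: dist_commute intro!: mult_left_mono)
        finally show "P x \<in> U" using \<delta>(2) tM by auto
        have "x \<notin> K" using that \<open>C \<subseteq> - K - ray_interior K\<close> by auto
        then have dx: "infdist x K > 0" using K by (simp add: infdist_pos_not_in_closed)
        have "P x - y x = (1 - t) *\<^sub>R (x - y x)" by (simp add: P_def algebra_simps)
        then have 1: "dist (P x) (y x) = (1 - t) * infdist x K" using y[of x] t by (simp add: dist_norm)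
        have "infdist (P x) K \<le> (1 - t) * infdist x K"
          using infdist_le[of "y x" K "P x"] y[of x] 1 by simp
        moreover have "infdist x K \<le> infdist (P x) K + dist x (P x)" by (rule infdist_triangle)
        ultimately have 2: "infdist x K = infdist (P x) K + dist (P x) x"
          using dP[of x] by (simp add: dist_commute algebra_simps)
        have "infdist (P x) K = (1 - t) * infdist x K"
          using 2 dP[of x] by (simp add: dist_commute algebra_simps)
        then have "infdist (P x) K > 0" using t dx by simp
        then have "P x \<notin> K" by auto
        moreover have "P x \<noteq> x" using dP[of x] t dx by auto
        \<comment> \<open>The old position \<open>x\<close> serves as the far endpoint: from
          \<open>P x\<close> back to \<open>x\<close> the distance grows at unit rate.\<close>
        ultimately have "P x \<in> ray_interior K" using 2 unfolding ray_interior_def by (auto intro!: exI[of _ x])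
        then show "P x \<notin> C" using \<open>C \<subseteq> - K - ray_interior K\<close> by auto
      qed
      then have PU: "P ` C \<subseteq> U - C" by auto
      have exp: "dist x x' \<le> 2 * dist (P x) (P x')" for x x'
      proof -
        \<comment> \<open>Each of \<open>y x\<close> and \<open>y x'\<close> is nearest to its own
          point; in the sum of the two squared comparisons all pure squares cancel and monotonicity
          of the selection remains.\<close>
        have "(dist x (y x))\<^sup>2 \<le> (dist x (y x'))\<^sup>2" "(dist x' (y x'))\<^sup>2 \<le> (dist x' (y x))\<^sup>2"
          using y[of x] y[of x'] infdist_le[of "y x'" K x] infdist_le[of "y x" K x']
          by (auto intro!: power_mono)
        then have mono: "(x - x') \<bullet> (y x - y x') \<ge> 0"
          by (simp add: dist_norm power2_norm_eq_inner inner_diff_left inner_diff_right inner_commute)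
        have "P x - P x' = (1 - t) *\<^sub>R (x - x') + t *\<^sub>R (y x - y x')"
          by (simp add: P_def algebra_simps)
        then have "(P x - P x') \<bullet> (x - x') = (1 - t) * (norm (x - x'))\<^sup>2 + t * ((x - x') \<bullet> (y x - y x'))"
          by (simp only: inner_add_left inner_scaleR_left power2_norm_eq_inner inner_commute[of "y x - y x'"])
        then have "(1 - t) * (norm (x - x'))\<^sup>2 \<le> (P x - P x') \<bullet> (x - x')" using mono t by simp
        also have "\<dots> \<le> norm (P x - P x') * norm (x - x')" by (rule norm_cauchy_schwarz)
        finally have "(1 - t) * norm (x - x') \<le> norm (P x - P x')"
          by (cases "x = x'") (auto simp: power2_eq_square)
        moreover have "1/2 * norm (x - x') \<le> (1 - t) * norm (x - x')"
          using t by (intro mult_right_mono) auto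
        ultimately show ?thesis by (simp add: dist_norm)
      qed
      have "measure lebesgue C \<le> (5 * 2) ^ DIM('a) * measure lebesgue (U - C)"
        using U \<open>compact C\<close> PU exp Cm
        by (intro measure_le_expansive_image[where P = P]) (auto simp: compact_imp_closed)
      also have "measure lebesgue (U - C) \<le> e"
        using U(3,4) \<open>e > 0\<close> by (simp add: emeasure_eq_measure2 ennreal_less_iff)
      finally show ?thesis by simp
    qed
    have "measure lebesgue C \<le> 0"
    proof (rule field_le_epsilon)
      fix e :: real assume "e > 0"
      then show "measure lebesgue C \<le> 0 + e" using small[of "e / 10 ^ DIM('a)"] by simp
    qed
    then show ?thesis using Cm by (simp add: negligible_iff_measure measure_le_0_iff)
  qed auto
  then have "negligible (C n)" for n using N(2,3) by blast
  then show ?thesis unfolding N(3) using N(1) by (intro negligible_Un negligible_Union_nat)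
qed

subsection \<open>Ball averages of the distance function\<close>

lemma AE_ray_interior:
  fixes K :: "'a::euclidean_space set"
  assumes "closed K" "K \<noteq> {}"
  shows "AE x in lborel. x \<notin> K \<longrightarrow> x \<in> ray_interior K"
proof -
  have "AE x in lebesgue. x \<notin> - K - ray_interior K"
    using negligible_compl_ray_interior[OF assms] unfolding negligible_iff_null_sets by (rule AE_not_in)
  then show ?thesis unfolding AE_completion_iff by auto
qed

lemma AE_lborel_translate:
  fixes x :: "'a::euclidean_space"
  assumes "AE y in lborel. P y"
  shows "AE y in lborel. P (x + y)"
proof -
  have "AE y in distr lborel borel ((+) x). P y"
    using assms by (simp only: lborel_distr_plus)
  then show ?thesis by (intro AE_distrD[of "(+) x" lborel borel P]) (simp_all add: measurable_lborel1)
qed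

text \<open>The ball averages and the integrals over \<open>lborel\<close> need a Borel
  representative of the gradient that is bounded everywhere. It is assembled from limits of
  coordinate difference quotients; values of norm above 1, which can occur only outside
  \<open>ray_interior K\<close>, are replaced by 0.\<close>

lemma borel_gradient_infdist:
  fixes K :: "'a::euclidean_space set"
  assumes K: "closed K" "K \<noteq> {}"
  obtains g :: "'a \<Rightarrow> 'a" where "g \<in> borel_measurable borel" "\<And>x. norm (g x) \<le> 1"
    "\<And>x. x \<in> ray_interior K \<Longrightarrow> GDERIV (\<lambda>z. infdist z K) x :> g x"
proof
  define q where "q b n x = real (Suc n) * (infdist (x + inverse (Suc n) *\<^sub>R b) K - infdist x K)" for b n x
  define h where "h x = (\<Sum>b\<in>Basis. lim (\<lambda>n. q b n x) *\<^sub>R b)" for x :: 'a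
  define g where "g x = (if norm (h x) \<le> 1 then h x else 0)" for x
  have "q b n \<in> borel_measurable borel" for b n
    unfolding q_def by (intro borel_measurable_continuous_onI continuous_intros)
  then have "h \<in> borel_measurable borel"
    unfolding h_def by (intro borel_measurable_sum borel_measurable_scaleR borel_measurable_lim_metric) auto
  then show "g \<in> borel_measurable borel" unfolding g_def by measurable
  show "norm (g x) \<le> 1" for x by (simp add: g_def)
  have *: "g x = e" if e: "norm e = 1" "GDERIV (\<lambda>z. infdist z K) x :> e" for x e
  proof -
    have "(\<lambda>n. q b n x) \<longlonglongrightarrow> b \<bullet> e" for b
    proof -
      have "((\<lambda>t. infdist (x + t *\<^sub>R b) K) has_real_derivative b \<bullet> e) (at 0)"
      proof -
        have "((\<lambda>t. x + t *\<^sub>R b) has_derivative (\<lambda>t. t *\<^sub>R b)) (at 0)"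
          by (auto intro!: derivative_eq_intros)
        moreover have "((\<lambda>z. infdist z K) has_derivative (\<lambda>h. h \<bullet> e)) (at (x + 0 *\<^sub>R b))"
          using e(2) by (simp add: gderiv_def)
        ultimately have "((\<lambda>t. infdist (x + t *\<^sub>R b) K) has_derivative (\<lambda>t. (t *\<^sub>R b) \<bullet> e)) (at 0)"
          by (rule has_derivative_compose)
        then show ?thesis
          unfolding has_field_derivative_def by (simp add: mult_commute_abs)
      qed
      then have "(\<lambda>t. (infdist (x + t *\<^sub>R b) K - infdist x K) / t) \<midarrow>0\<rightarrow> b \<bullet> e"
        by (simp add: has_field_derivative_iff)
      moreover have "filterlim (\<lambda>n. inverse (real (Suc n))) (at 0) sequentially"
        using LIMSEQ_inverse_real_of_nat by (auto simp: filterlim_at intro!: always_eventually)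
      ultimately have "(\<lambda>n. (infdist (x + inverse (Suc n) *\<^sub>R b) K - infdist x K) / inverse (real (Suc n)))
          \<longlonglongrightarrow> b \<bullet> e"
        by (rule filterlim_compose)
      then show ?thesis unfolding q_def by (simp add: field_simps)
    qed
    then have "lim (\<lambda>n. q b n x) = b \<bullet> e" for b by (rule limI)
    then have "h x = (\<Sum>b\<in>Basis. (b \<bullet> e) *\<^sub>R b)" unfolding h_def by simp
    also have "\<dots> = e" by (simp only: inner_commute[of _ e] euclidean_representation)
    finally show ?thesis using e by (simp add: g_def)
  qed
  show "GDERIV (\<lambda>z. infdist z K) x :> g x" if "x \<in> ray_interior K" for x
    using ray_interior_gradient[OF K that] * by metis
qed

text \<open>The mean of \<open>f\<close> over the ball around \<open>x\<close>, with the ball moved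
  to the origin: \<open>x\<close> then occurs only in the integrand, as differentiation under the
  integral requires. For continuity in \<open>x\<close> the form in \<open>ball_avg_eq_LINT\<close>,
  with a moving ball and a fixed integrand, is the convenient one.\<close>

definition ball_avg :: "real \<Rightarrow> ('a::euclidean_space \<Rightarrow> 'b::euclidean_space) \<Rightarrow> 'a \<Rightarrow> 'b" where
  "ball_avg r f x = (LINT y:ball 0 r|lborel. f (x + y)) /\<^sub>R measure lborel (ball 0 r :: 'a set)"

lemma set_integrable_ball_bounded:
  fixes f :: "'a::euclidean_space \<Rightarrow> 'b::euclidean_space"
  assumes "f \<in> borel_measurable borel" "\<And>y. y \<in> ball a r \<Longrightarrow> norm (f y) \<le> B"
  shows "set_integrable lborel (ball a r) f"
  unfolding set_integrable_def
  by (rule integrableI_bounded_set_indicator[where B = B])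
    (use assms emeasure_lborel_ball_finite[of a r] in \<open>auto intro!: AE_I2\<close>)

lemma borel_measurable_ball_scaleR:
  fixes f :: "'a::euclidean_space \<Rightarrow> 'b::euclidean_space"
  assumes "f \<in> borel_measurable borel"
  shows "(\<lambda>z. indicator (ball a r) z *\<^sub>R f z) \<in> borel_measurable borel"
  by (intro borel_measurable_scaleR borel_measurable_indicator assms borel_open open_ball)

lemma measure_ball_pos:
  "r > 0 \<Longrightarrow> measure lborel (ball a r :: 'a::euclidean_space set) > 0"
  by (simp add: content_ball)

lemma ball_avg_ge:
  fixes f :: "'a::euclidean_space \<Rightarrow> real"
  assumes "r > 0" "set_integrable lborel (ball 0 r) (\<lambda>y. f (x + y))"
    and "AE y in lborel. y \<in> ball 0 r \<longrightarrow> c \<le> f (x + y)"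
  shows "c \<le> ball_avg r f x"
proof -
  have "(LINT y:ball (0::'a) r|lborel. c) \<le> (LINT y:ball 0 r|lborel. f (x + y))"
  proof (rule set_integral_mono_AE)
    show "set_integrable lborel (ball (0::'a) r) (\<lambda>y. c)"
      by (rule set_integrable_ball_bounded[where B = "\<bar>c\<bar>"]) auto
    show "AE y\<in>ball 0 r in lborel. c \<le> f (x + y)"
      using assms(3) by auto
  qed (rule assms)
  then show ?thesis
    using measure_ball_pos[OF \<open>r > 0\<close>, of "0::'a"]
    by (simp add: ball_avg_def set_lebesgue_integral_def field_simps)
qed

lemma ball_avg_uminus:
  "ball_avg r (\<lambda>x. - f x) x = - ball_avg r f x"
  by (simp add: ball_avg_def set_lebesgue_integral_def)

lemma ball_avg_inner:
  fixes f :: "'a::euclidean_space \<Rightarrow> 'b::euclidean_space"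
  assumes "set_integrable lborel (ball 0 r) (\<lambda>y. f (x + y))"
  shows "c \<bullet> ball_avg r f x = ball_avg r (\<lambda>z. c \<bullet> f z) x"
proof -
  have "(LINT y|lborel. c \<bullet> (indicator (ball 0 r) y *\<^sub>R f (x + y)))
      = c \<bullet> (LINT y|lborel. indicator (ball 0 r) y *\<^sub>R f (x + y))"
    using assms unfolding set_integrable_def by (rule integral_inner_right)
  then show ?thesis by (simp add: ball_avg_def set_lebesgue_integral_def)
qed

lemma ball_avg_le:
  fixes f :: "'a::euclidean_space \<Rightarrow> real"
  assumes "r > 0" "set_integrable lborel (ball 0 r) (\<lambda>y. f (x + y))"
    and "AE y in lborel. y \<in> ball 0 r \<longrightarrow> f (x + y) \<le> c"
  shows "ball_avg r f x \<le> c"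
proof -
  have "set_integrable lborel (ball 0 r) (\<lambda>y. - f (x + y))"
    using assms(2) by (simp add: set_integrable_def)
  then show ?thesis
    using ball_avg_ge[of r "\<lambda>z. - f z" x "- c"] assms by (simp add: ball_avg_uminus)
qed

lemma norm_ball_avg_le:
  fixes f :: "'a::euclidean_space \<Rightarrow> 'b::euclidean_space"
  assumes "r > 0" "f \<in> borel_measurable borel" "\<And>y. norm (f y) \<le> B"
  shows "norm (ball_avg r f x) \<le> B"
proof -
  have "norm (LINT y:ball 0 r|lborel. f (x + y)) \<le> (LINT y:ball 0 r|lborel. norm (f (x + y)))"
    by (rule set_integral_norm_bound, rule set_integrable_ball_bounded[where B = B])
      (use assms in auto)
  then have "norm (ball_avg r f x) \<le> ball_avg r (\<lambda>y. norm (f y)) x"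
    by (simp add: ball_avg_def divide_inverse mult_left_mono)
  also have "\<dots> \<le> B"
    by (rule ball_avg_le, fact, rule set_integrable_ball_bounded[where B = B])
      (use assms in auto)
  finally show ?thesis .
qed

lemma ball_avg_Lipschitz:
  fixes f :: "'a::euclidean_space \<Rightarrow> real"
  assumes "r > 0" and L: "\<And>x y. \<bar>f x - f y\<bar> \<le> dist x y"
  shows "\<bar>ball_avg r f x - f x\<bar> \<le> r"
proof -
  have "continuous_on UNIV f"
    using L le_less_trans unfolding continuous_on_iff dist_real_def by (metis (no_types))
  then have f: "f \<in> borel_measurable borel" by (rule borel_measurable_continuous_onI)
  have b: "\<bar>f (x + y) - f x\<bar> \<le> r" if "y \<in> ball 0 r" for y
    using L[of "x + y" x] that by (simp add: dist_norm)
  have i: "set_integrable lborel (ball 0 r) (\<lambda>y. f (x + y))"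
  proof (rule set_integrable_ball_bounded)
    show "norm (f (x + y)) \<le> \<bar>f x\<bar> + r" if "y \<in> ball 0 r" for y
      using b[OF that] by simp
  qed (use f in simp)
  have "f x - r \<le> f (x + y) \<and> f (x + y) \<le> f x + r" if "y \<in> ball 0 r" for y
    using b[OF that] by linarith
  then have "f x - r \<le> ball_avg r f x" "ball_avg r f x \<le> f x + r"
    by (auto intro!: ball_avg_ge[OF \<open>r > 0\<close> i] ball_avg_le[OF \<open>r > 0\<close> i])
  then show ?thesis by simp
qed

lemma ball_avg_eq_LINT:
  fixes f :: "'a::euclidean_space \<Rightarrow> 'b::euclidean_space"
  assumes "f \<in> borel_measurable borel"
  shows "ball_avg r f x = (LINT z:ball x r|lborel. f z) /\<^sub>R measure lborel (ball 0 r :: 'a set)"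
proof -
  have "(LINT z|lborel. indicator (ball x r) z *\<^sub>R f z)
      = (LINT z|distr lborel borel ((+) x). indicator (ball x r) z *\<^sub>R f z)"
    by (simp add: lborel_distr_plus)
  also have "\<dots> = (LINT y|lborel. indicator (ball x r) (x + y) *\<^sub>R f (x + y))"
    using borel_measurable_ball_scaleR[OF assms] by (intro integral_distr) auto
  also have "\<dots> = (LINT y|lborel. indicator (ball 0 r) y *\<^sub>R f (x + y))"
    by (intro Bochner_Integration.integral_cong) (auto simp: indicator_def dist_norm)
  finally show ?thesis by (simp add: ball_avg_def set_lebesgue_integral_def)
qed

text \<open>Even for discontinuous \<open>f\<close>, the indicators of the moving balls converge off
  the limiting sphere, which is a null set; one large closed ball carries the dominating
  function.\<close>

lemma continuous_on_ball_avg: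
  fixes f :: "'a::euclidean_space \<Rightarrow> 'b::euclidean_space"
  assumes f: "f \<in> borel_measurable borel" "\<And>y. norm (f y) \<le> B"
  shows "continuous_on UNIV (ball_avg r f)"
proof -
  have "(\<lambda>n. LINT z:ball (u n) r|lborel. f z) \<longlonglongrightarrow> (LINT z:ball x r|lborel. f z)"
    if u: "u \<longlonglongrightarrow> x" for u x
  proof -
    obtain M where M: "\<And>n. dist (u n) x \<le> M"
      using convergent_imp_bounded[OF u] bounded_any_center[of _ x] by (metis dist_commute rangeI)
    show ?thesis unfolding set_lebesgue_integral_def
    proof (rule integral_dominated_convergence[where w = "\<lambda>z. indicator (cball x (r + M)) z * B"])
      show "(\<lambda>z. indicator (ball x r) z *\<^sub>R f z) \<in> borel_measurable lborel"
        "(\<lambda>z. indicator (ball (u n) r) z *\<^sub>R f z) \<in> borel_measurable lborel" for n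
        using borel_measurable_ball_scaleR[OF f(1)] by simp_all
      show "integrable lborel (\<lambda>z. indicator (cball x (r + M)) z * B)"
        using emeasure_lborel_cball_finite[of x "r + M"]
        by (intro integrable_mult_left integrable_real_indicator) auto
      have B: "B \<ge> 0" using f(2)[of undefined] norm_ge_zero order_trans by blast
      show "AE z in lborel. norm (indicator (ball (u n) r) z *\<^sub>R f z) \<le> indicator (cball x (r + M)) z * B" for n
      proof (rule AE_I2)
        fix z
        have "dist x z \<le> r + M" if "z \<in> ball (u n) r"
          using that M[of n] dist_triangle[of x z "u n"] by (simp add: dist_commute)
        then show "norm (indicator (ball (u n) r) z *\<^sub>R f z) \<le> indicator (cball x (r + M)) z * B"
          using f(2)[of z] B by (auto simp: indicator_def)
      qed
      have "negligible (sphere x r)" by (rule negligible_sphere)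
      then have "AE z in lborel. z \<notin> sphere x r"
        by (metis AE_not_in AE_completion_iff negligible_iff_null_sets)
      then show "AE z in lborel. (\<lambda>n. indicator (ball (u n) r) z *\<^sub>R f z) \<longlonglongrightarrow> indicator (ball x r) z *\<^sub>R f z"
      proof eventually_elim
        case (elim z)
        have lim: "(\<lambda>n. dist (u n) z) \<longlonglongrightarrow> dist x z" by (intro tendsto_intros u)
        have "eventually (\<lambda>n. indicator (ball (u n) r) z *\<^sub>R f z = indicator (ball x r) z *\<^sub>R f z) sequentially"
        proof (cases "dist x z < r")
          case True
          then have "eventually (\<lambda>n. dist (u n) z < r) sequentially" using lim by (simp add: order_tendstoD)
          then show ?thesis by eventually_elim (use True in auto)
        next
          case False
          then have "dist x z > r" using elim by auto
          then have "eventually (\<lambda>n. dist (u n) z > r) sequentially" using lim by (simp add: order_tendstoD)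
          then show ?thesis by eventually_elim (use False in auto)
        qed
        then show ?case by (rule tendsto_eventually)
      qed
    qed
  qed
  then show ?thesis
    unfolding continuous_on_sequentially by (auto simp: ball_avg_eq_LINT[OF f(1)] o_def intro!: tendsto_intros)
qed

text \<open>Dominated convergence for the normalised remainders: they are bounded by 2, one unit
  from the Lipschitz bound of the distance and one from \<open>norm (g x) \<le> 1\<close>. The
  condition \<open>r \<le> infdist x K\<close> keeps the open ball off \<open>K\<close>, so that
  almost every point of it lies in \<open>ray_interior K\<close>.\<close>

lemma GDERIV_ball_avg:
  fixes K :: "'a::euclidean_space set"
  assumes K: "closed K" "K \<noteq> {}"
    and g: "g \<in> borel_measurable borel" "\<And>x. norm (g x) \<le> 1"
      "\<And>x. x \<in> ray_interior K \<Longrightarrow> GDERIV (\<lambda>z. infdist z K) x :> g x"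
    and r: "r > 0" "r \<le> infdist x K"
  shows "GDERIV (ball_avg r (\<lambda>z. infdist z K)) x :> ball_avg r g x"
proof -
  let ?d = "\<lambda>z. infdist z K"
  let ?B = "ball (0::'a) r"
  have off: "x + y \<notin> K" if "y \<in> ?B" for y
    using infdist_le[of "x + y" K x] that r by (auto simp: dist_norm)
  have i1: "set_integrable lborel ?B (\<lambda>y. ?d (x + v + y))" for v
  proof (rule set_integrable_ball_bounded[where B = "?d (x + v) + r"])
    show "(\<lambda>y. ?d (x + v + y)) \<in> borel_measurable borel"
      by (intro borel_measurable_continuous_onI continuous_intros)
    show "norm (?d (x + v + y)) \<le> ?d (x + v) + r" if "y \<in> ?B" for y
      using infdist_triangle[of "x + v + y" K "x + v"] that by (simp add: infdist_nonneg dist_norm)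
  qed
  have i2: "set_integrable lborel ?B (\<lambda>y. g (x + y))"
    by (rule set_integrable_ball_bounded[where B = 1]) (use g in auto)
  have i3: "set_integrable lborel ?B (\<lambda>y. v \<bullet> g (x + y))" for v
    using integrable_inner_right[of v lborel "\<lambda>y. indicator ?B y *\<^sub>R g (x + y)"] i2
    by (simp add: set_integrable_def)
  define F where "F v y = (?d (x + v + y) - ?d (x + y) - v \<bullet> g (x + y)) / norm v" for v y
  have eq: "(ball_avg r ?d (x + v) - ball_avg r ?d x - v \<bullet> ball_avg r g x) / norm v
      = (LINT y:?B|lborel. F v y) / measure lborel ?B" for v
  proof -
    have "(LINT y:?B|lborel. F v y)
        = ((LINT y:?B|lborel. ?d (x + v + y)) - (LINT y:?B|lborel. ?d (x + y))
            - (LINT y:?B|lborel. v \<bullet> g (x + y))) / norm v"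
      unfolding F_def using i1[of v] i1[of 0] i3[of v]
      by (simp add: set_integral_diff)
    then show ?thesis
      unfolding ball_avg_inner[OF i2]
      by (simp add: ball_avg_def divide_inverse right_diff_distrib left_diff_distrib ac_simps)
  qed
  have lim: "(\<lambda>n. (LINT y:?B|lborel. F (h n) y) / measure lborel ?B) \<longlonglongrightarrow> 0"
    if h: "\<And>n. h n \<noteq> 0" "h \<longlonglongrightarrow> 0" for h
  proof -
    have "(\<lambda>n. LINT y:?B|lborel. F (h n) y) \<longlonglongrightarrow> (LINT y:?B|lborel. (0::real))"
      unfolding set_lebesgue_integral_def
    proof (rule integral_dominated_convergence[where w = "\<lambda>y. indicator ?B y * 2"])
      show "(\<lambda>y. indicator ?B y *\<^sub>R (0::real)) \<in> borel_measurable lborel" by simp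
      have [measurable]: "(\<lambda>y. ?d (c + y)) \<in> borel_measurable borel" for c
        by (intro borel_measurable_continuous_onI continuous_intros)
      show "(\<lambda>y. indicator ?B y *\<^sub>R F (h n) y) \<in> borel_measurable lborel" for n
      proof -
        have "F (h n) \<in> borel_measurable borel"
          unfolding F_def using g(1) by (auto simp: add.assoc[symmetric])
        then show ?thesis using borel_measurable_ball_scaleR[of "F (h n)" 0 r] by simp
      qed
      show "integrable lborel (\<lambda>y. indicator ?B y * 2 :: real)"
        using emeasure_lborel_ball_finite[of "0::'a" r]
        by (intro integrable_mult_left integrable_real_indicator) auto
      show "AE y in lborel. norm (indicator ?B y *\<^sub>R F (h n) y) \<le> indicator ?B y * 2" for n
      proof (rule AE_I2)
        fix y
        have "\<bar>?d (x + h n + y) - ?d (x + y)\<bar> \<le> norm (h n)"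
          using infdist_triangle_abs[of "x + h n + y" K "x + y"] by (simp add: dist_norm)
        moreover have "\<bar>h n \<bullet> g (x + y)\<bar> \<le> norm (h n) * 1"
          using Cauchy_Schwarz_ineq2[of "h n" "g (x + y)"] g(2)[of "x + y"]
          by (meson mult_left_mono norm_ge_zero order_trans)
        ultimately have "\<bar>F (h n) y\<bar> \<le> 2"
          using h(1)[of n] by (simp add: F_def divide_le_eq)
        then show "norm (indicator ?B y *\<^sub>R F (h n) y) \<le> indicator ?B y * 2"
          by (auto simp: indicator_def)
      qed
      show "AE y in lborel. (\<lambda>n. indicator ?B y *\<^sub>R F (h n) y) \<longlonglongrightarrow> indicator ?B y *\<^sub>R 0"
        using AE_lborel_translate[OF AE_ray_interior[OF K], of x]
      proof eventually_elim
        case (elim y)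
        show ?case
        proof (cases "y \<in> ?B")
          case True
          then have "x + y \<in> ray_interior K" using elim off by auto
          then have "GDERIV ?d (x + y) :> g (x + y)" by (rule g(3))
          then have "(\<lambda>v. norm (?d (x + y + v) - ?d (x + y) - v \<bullet> g (x + y)) / norm v) \<midarrow>0\<rightarrow> 0"
            unfolding gderiv_def has_derivative_at by simp
          then have "(\<lambda>n. norm (?d (x + y + h n) - ?d (x + y) - h n \<bullet> g (x + y)) / norm (h n)) \<longlonglongrightarrow> 0"
            using h by (simp add: tendsto_at_iff_sequentially o_def)
          then have "(\<lambda>n. norm (F (h n) y)) \<longlonglongrightarrow> 0" by (simp add: F_def ac_simps)
          then have "(\<lambda>n. F (h n) y) \<longlonglongrightarrow> 0" by (rule tendsto_norm_zero_cancel)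
          then show ?thesis using True by simp
        qed auto
      qed
    qed
    then have "(\<lambda>n. LINT y:?B|lborel. F (h n) y) \<longlonglongrightarrow> 0" by simp
    then show ?thesis by (rule tendsto_divide_zero)
  qed
  have "(\<lambda>v. (ball_avg r ?d (x + v) - ball_avg r ?d x - v \<bullet> ball_avg r g x) / norm v) \<midarrow>0\<rightarrow> 0"
    unfolding eq using lim by (auto simp: tendsto_at_iff_sequentially o_def)
  from tendsto_norm_zero[OF this] show ?thesis
    unfolding gderiv_def has_derivative_at by (simp add: bounded_linear_inner_left)
qed

text \<open>The inner product with the fixed vector \<open>g x\<close> passes inside the average.
  From below, \<open>ray_interior_inner_gradients\<close> bounds the integrand almost everywhere on
  the ball with an error linear in the radius; from above, both vectors have norm at most 1.\<close>

lemma inner_ball_avg_gradient_tendsto: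
  fixes K :: "'a::euclidean_space set"
  assumes K: "closed K" "K \<noteq> {}"
    and g: "g \<in> borel_measurable borel" "\<And>x. norm (g x) \<le> 1"
      "\<And>x. x \<in> ray_interior K \<Longrightarrow> GDERIV (\<lambda>z. infdist z K) x :> g x"
    and x: "x \<in> ray_interior K" and r: "\<And>n. r n > 0" "r \<longlonglongrightarrow> 0"
  shows "(\<lambda>n. g x \<bullet> ball_avg (r n) g x) \<longlonglongrightarrow> 1"
proof -
  obtain w where w: "x \<notin> K" "w \<noteq> x" "infdist w K = infdist x K + dist x w"
    using x by (auto simp: ray_interior_def)
  define s \<delta> where "s = dist x w" and "\<delta> = infdist x K"
  have s: "s > 0" "\<delta> > 0" using w K by (auto simp: s_def \<delta>_def infdist_pos_not_in_closed)
  have int: "set_integrable lborel (ball 0 \<rho>) (\<lambda>y. g x \<bullet> g (x + y))" for \<rho>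
  proof (rule set_integrable_ball_bounded[where B = 1])
    show "norm (g x \<bullet> g (x + y)) \<le> 1" for y
      using Cauchy_Schwarz_ineq2[of "g x" "g (x + y)"] g(2)[of x] g(2)[of "x + y"]
        mult_mono[of "norm (g x)" 1 "norm (g (x + y))" 1] by simp
  qed (use g in auto)
  have intg: "set_integrable lborel (ball 0 \<rho>) (\<lambda>y. g (x + y))" for \<rho>
    by (rule set_integrable_ball_bounded[where B = 1]) (use g in auto)
  \<comment> \<open>For \<rho> at most \<delta>/2 the distance stays above \<delta>/2 on the ball,
    which turns the error \<open>2 * \<rho> / infdist (x + y) K\<close> into at most
    \<open>4 * \<rho> / \<delta>\<close>.\<close>
  have low: "1 - (2 / s + 4 / \<delta>) * \<rho> \<le> g x \<bullet> ball_avg \<rho> g x" if \<rho>: "\<rho> > 0" "2 * \<rho> \<le> s" "2 * \<rho> \<le> \<delta>" for \<rho>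
    unfolding ball_avg_inner[OF intg]
  proof (rule ball_avg_ge[OF \<rho>(1) int])
    show "AE y in lborel. y \<in> ball 0 \<rho> \<longrightarrow> 1 - (2 / s + 4 / \<delta>) * \<rho> \<le> g x \<bullet> g (x + y)"
      using AE_lborel_translate[OF AE_ray_interior[OF K], of x]
    proof (eventually_elim, intro impI)
      fix y assume y: "x + y \<notin> K \<longrightarrow> x + y \<in> ray_interior K" "y \<in> ball 0 \<rho>"
      have d: "\<delta> / 2 \<le> infdist (x + y) K"
        using infdist_triangle[of x K "x + y"] y(2) \<rho> by (simp add: \<delta>_def dist_norm)
      then have "x + y \<notin> K" using s by auto
      with y have xy: "x + y \<in> ray_interior K" by simp
      have "1 - 2 * \<rho> / s - 2 * \<rho> / infdist (x + y) K \<le> g x \<bullet> g (x + y)"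
        using ray_interior_inner_gradients[OF K xy w(1-3), of \<rho>] y(2) \<rho>
        by (simp add: grad_eqI[OF g(3)[OF x]] grad_eqI[OF g(3)[OF xy]] s_def dist_norm)
      moreover have "2 * \<rho> / infdist (x + y) K \<le> 2 * \<rho> / (\<delta> / 2)"
        using d s \<rho> by (intro divide_left_mono) auto
      ultimately show "1 - (2 / s + 4 / \<delta>) * \<rho> \<le> g x \<bullet> g (x + y)"
        by (simp add: algebra_simps)
    qed
  qed
  have up: "g x \<bullet> ball_avg \<rho> g x \<le> 1" if "\<rho> > 0" for \<rho>
  proof -
    have "g x \<bullet> ball_avg \<rho> g x \<le> norm (g x) * norm (ball_avg \<rho> g x)" by (rule norm_cauchy_schwarz)
    also have "\<dots> \<le> 1 * 1"
      using g(2)[of x] norm_ball_avg_le[OF that g(1,2)] by (intro mult_mono) auto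
    finally show ?thesis by simp
  qed
  show ?thesis
  proof (rule tendsto_sandwich)
    have "eventually (\<lambda>n. r n < min (s / 2) (\<delta> / 2)) sequentially"
      using r(2) s by (intro order_tendstoD(2)) auto
    then show "eventually (\<lambda>n. 1 - (2 / s + 4 / \<delta>) * r n \<le> g x \<bullet> ball_avg (r n) g x) sequentially"
      by eventually_elim (intro low, use r in auto)
    show "eventually (\<lambda>n. g x \<bullet> ball_avg (r n) g x \<le> 1) sequentially" using up r by simp
    have "(\<lambda>n. 1 - (2 / s + 4 / \<delta>) * r n) \<longlonglongrightarrow> 1 - (2 / s + 4 / \<delta>) * 0"
      by (intro tendsto_intros r)
    then show "(\<lambda>n. 1 - (2 / s + 4 / \<delta>) * r n) \<longlonglongrightarrow> 1" by simp
  qed simp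
qed

subsection \<open>Calculus\<close>

text \<open>\<open>Ck_on 1\<close> is phrased through directional derivatives. The derivatives along
  \<open>Basis\<close> are the coordinates of the gradient, so this lemma and the next one identify
  the class with that of functions having a continuous gradient.\<close>

lemma Ck_on_1_gradient:
  fixes f :: "'a::euclidean_space \<Rightarrow> real"
  assumes "Ck_on 1 f UNIV"
  shows "GDERIV f x :> grad f x" and "continuous_on UNIV (grad f)"
proof -
  define G where "G x = (\<Sum>b\<in>Basis. frechet_derivative f (at x) b *\<^sub>R b)" for x
  have d: "f differentiable_on UNIV" and c: "\<And>v. continuous_on UNIV (\<lambda>x. frechet_derivative f (at x) v)"
    using assms by (auto simp: One_nat_def)
  have G: "GDERIV f x :> G x" for x
  proof -
    have fd: "(f has_derivative frechet_derivative f (at x)) (at x)"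
      using d by (auto simp: differentiable_on_def frechet_derivative_works)
    then interpret bounded_linear "frechet_derivative f (at x)" by (rule has_derivative_bounded_linear)
    have "frechet_derivative f (at x) v = v \<bullet> G x" for v
    proof -
      have "frechet_derivative f (at x) v = frechet_derivative f (at x) (\<Sum>b\<in>Basis. (v \<bullet> b) *\<^sub>R b)"
        by (simp add: euclidean_representation)
      also have "\<dots> = v \<bullet> G x"
        by (simp add: sum scaleR G_def inner_sum_right mult.commute)
      finally show ?thesis .
    qed
    then have "frechet_derivative f (at x) = (\<lambda>v. v \<bullet> G x)" by auto
    with fd show ?thesis by (simp add: gderiv_def)
  qed
  then have eq: "grad f = G" by (auto simp: fun_eq_iff intro: grad_eqI)
  show "GDERIV f x :> grad f x" using G by (simp add: eq)
  show "continuous_on UNIV (grad f)"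
    unfolding eq G_def by (intro continuous_intros c)
qed

lemma Ck_on_1I:
  fixes f :: "'a::euclidean_space \<Rightarrow> real"
  assumes G: "\<And>x. GDERIV f x :> G x" and c: "continuous_on UNIV G"
  shows "Ck_on 1 f UNIV"
proof -
  have "frechet_derivative f (at x) v = v \<bullet> G x" for x v
    using frechet_derivative_at[OF G[unfolded gderiv_def], of x] by metis
  moreover have "f differentiable_on UNIV"
    using G unfolding gderiv_def differentiable_on_def differentiable_def by blast
  ultimately show ?thesis
    using c by (auto simp: One_nat_def intro!: continuous_intros)
qed

lemma integrable_bounded_compact_support:
  fixes f :: "'a::euclidean_space \<Rightarrow> real"
  assumes "f \<in> borel_measurable borel" "compact S"
    and "\<And>x. x \<in> S \<Longrightarrow> \<bar>f x\<bar> \<le> B" "\<And>x. x \<notin> S \<Longrightarrow> f x = 0"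
  shows "integrable lborel f"
proof -
  have "integrable lborel (\<lambda>x. indicator S x *\<^sub>R f x)"
    using assms(1-3) emeasure_compact_finite[OF assms(2)]
    by (intro integrableI_bounded_set_indicator[where B = B]) (auto simp: compact_imp_closed)
  also have "(\<lambda>x. indicator S x *\<^sub>R f x) = f"
    using assms(4) by (fastforce simp: indicator_def)
  finally show ?thesis .
qed

lemma bounded_on_compact:
  fixes f :: "'a::topological_space \<Rightarrow> 'b::real_normed_vector"
  assumes "compact S" "continuous_on S f"
  obtains B where "B \<ge> 0" "\<And>x. x \<in> S \<Longrightarrow> norm (f x) \<le> B"
proof -
  have "bounded (f ` S)" using assms by (intro compact_imp_bounded compact_continuous_image)
  then obtain B where "\<And>x. x \<in> S \<Longrightarrow> norm (f x) \<le> B" by (auto simp: bounded_iff)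
  then have "\<And>x. x \<in> S \<Longrightarrow> norm (f x) \<le> \<bar>B\<bar>" by force
  then show ?thesis using that[of "\<bar>B\<bar>"] by simp
qed

text \<open>An exponent of at least 2 removes the kink of the absolute value at 0, so a power of
  \<bar>\<phi>\<bar> inherits \<open>C^1\<close> regularity from \<phi>. Writing the derivative with
  a trailing factor \<open>t\<close> covers both signs by one continuous formula.\<close>

lemma DERIV_abs_power:
  fixes t :: real
  shows "((\<lambda>t. \<bar>t\<bar> ^ (m + 2)) has_real_derivative (real m + 2) * \<bar>t\<bar> ^ m * t) (at t)"
proof (cases t "0 :: real" rule: linorder_cases)
  case greater
  have "((\<lambda>t. t ^ (m + 2)) has_real_derivative (real m + 2) * \<bar>t\<bar> ^ m * t) (at t)"
    using greater DERIV_power_Suc[OF DERIV_ident, of "Suc m" t UNIV] by (simp add: ac_simps)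
  then show ?thesis
    by (rule has_field_derivative_transform_within_open[where S = "{0<..}"]) (use greater in auto)
next
  case less
  have "((\<lambda>t. (- t) ^ (m + 2)) has_real_derivative (real m + 2) * \<bar>t\<bar> ^ m * t) (at t)"
    using less DERIV_power_Suc[OF DERIV_minus[OF DERIV_ident], of "Suc m" t UNIV]
    by (simp add: ac_simps)
  then show ?thesis
    by (rule has_field_derivative_transform_within_open[where S = "{..<0}"]) (use less in auto)
next
  case equal
  have "(\<lambda>h::real. \<bar>h\<bar> ^ m * h) \<midarrow>0\<rightarrow> \<bar>0\<bar> ^ m * 0"
    by (intro tendsto_intros)
  moreover have "\<forall>\<^sub>F h in at 0. \<bar>h\<bar> ^ m * h = \<bar>h\<bar> ^ (m + 2) / (h::real)"
  proof (rule eventually_at_filter[THEN iffD2], rule always_eventually, intro allI impI)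
    fix h :: real assume "h \<noteq> 0"
    have "\<bar>h\<bar> ^ (m + 2) = \<bar>h\<bar> ^ m * (h * h)"
      unfolding power_add power2_abs by (simp add: power2_eq_square)
    then show "\<bar>h\<bar> ^ m * h = \<bar>h\<bar> ^ (m + 2) / h"
      using \<open>h \<noteq> 0\<close> by (simp del: power_add_numeral add: mult.assoc[symmetric])
  qed
  ultimately have "(\<lambda>h::real. \<bar>h\<bar> ^ (m + 2) / h) \<midarrow>0\<rightarrow> 0"
    by (simp add: tendsto_cong)
  then show ?thesis by (simp add: equal has_field_derivative_iff)
qed

text \<open>Bernoulli's inequality for the ratio of \<open>b\<close> to \<open>a = l * c\<close>,
  multiplied by \<open>a ^ Suc n\<close> and divided by \<open>l ^ n\<close>.\<close>

lemma Young_power: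
  fixes b c l :: real
  assumes "b \<ge> 0" "c \<ge> 0" "l > 0"
  shows "real (Suc n) * c ^ n * b \<le> real n * l * c ^ Suc n + b ^ Suc n / l ^ n"
proof (cases "c = 0")
  case True
  then show ?thesis using assms by (cases n) auto
next
  case False
  define a where "a = l * c"
  have a: "a > 0" using False assms by (simp add: a_def)
  have "1 + real (Suc n) * (b / a - 1) \<le> (1 + (b / a - 1)) ^ Suc n"
    by (rule Bernoulli_inequality) (use a assms in auto)
  then have "a ^ Suc n * (1 + real (Suc n) * (b / a - 1)) \<le> a ^ Suc n * (b / a) ^ Suc n"
    using a by (intro mult_left_mono) auto
  also have "\<dots> = b ^ Suc n" using a by (simp add: power_divide)
  also have "a ^ Suc n * (1 + real (Suc n) * (b / a - 1)) = real (Suc n) * a ^ n * b - real n * a ^ Suc n"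
    using a by (simp add: field_simps)
  finally have "real (Suc n) * a ^ n * b \<le> real n * a ^ Suc n + b ^ Suc n" by simp
  then have "(real (Suc n) * a ^ n * b) / l ^ n \<le> (real n * a ^ Suc n + b ^ Suc n) / l ^ n"
    using assms by (intro divide_right_mono) auto
  moreover have "real (Suc n) * a ^ n * b / l ^ n = real (Suc n) * c ^ n * b"
    using assms by (simp add: a_def power_mult_distrib)
  moreover have "(real n * a ^ Suc n + b ^ Suc n) / l ^ n = real n * l * c ^ Suc n + b ^ Suc n / l ^ n"
    using assms by (simp add: a_def power_mult_distrib add_divide_distrib)
  ultimately show ?thesis by simp
qed

text \<open>With \<open>k = m + 2\<close> this is \<open>t\<^bsup>-k\<^esup> X\<^bsup>k-1\<^esup>(t / D)\<close>.\<close>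

definition Hardy_profile :: "real \<Rightarrow> nat \<Rightarrow> real \<Rightarrow> real" where
  "Hardy_profile D m t = 1 / (t ^ (m + 2) * ln (D / t) ^ (m + 1))"

definition Hardy_profile' :: "real \<Rightarrow> nat \<Rightarrow> real \<Rightarrow> real" where
  "Hardy_profile' D m t = (real m + 1) / (t ^ (m + 3) * ln (D / t) ^ (m + 2))
    - (real m + 2) / (t ^ (m + 3) * ln (D / t) ^ (m + 1))"

lemma DERIV_Hardy_profile:
  assumes "0 < t" "t < D"
  shows "(Hardy_profile D m has_real_derivative Hardy_profile' D m t) (at t)"
proof -
  have L: "ln (D / t) > 0" using assms by simp
  have "((\<lambda>t. D / t) has_real_derivative - (D / t\<^sup>2)) (at t)"
    using assms by (auto intro!: derivative_eq_intros simp: power2_eq_square)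
  then have dL: "((\<lambda>t. ln (D / t)) has_real_derivative - (1 / t)) (at t)"
    using assms by (auto intro!: derivative_eq_intros simp: field_simps power2_eq_square)
  show ?thesis
    unfolding Hardy_profile_def
  proof (rule DERIV_cong[OF DERIV_divide[OF DERIV_const DERIV_mult]])
    show "((\<lambda>t. t ^ (m + 2)) has_real_derivative (real m + 2) * t ^ (m + 1)) (at t)"
      using DERIV_power_Suc[OF DERIV_ident, of "Suc m" t UNIV] by (simp add: ac_simps)
    show "((\<lambda>t. ln (D / t) ^ (m + 1)) has_real_derivative (real m + 1) * (- (1 / t) * ln (D / t) ^ m)) (at t)"
      using DERIV_power_Suc[OF dL, of m] by (simp add: ac_simps)
    \<comment> \<open>\<open>T\<close>, \<open>L\<close>, \<open>M\<close> and \<open>c\<close>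
      stand for \<open>t ^ m\<close>, \<open>ln (D / t)\<close>, \<open>ln (D / t) ^ m\<close> and
      \<open>real m + 1\<close>; with the symbolic exponents abstracted away, the quotient rule
      becomes a plain field identity.\<close>
    have alg: "(0 * (t\<^sup>2 * T * (L * M)) - 1 * ((c + 1) * (t * T) * (L * M) + c * (- (1 / t) * M) * (t\<^sup>2 * T)))
        / (t\<^sup>2 * T * (L * M) * (t\<^sup>2 * T * (L * M)))
      = c / (t ^ 3 * T * (L\<^sup>2 * M)) - (c + 1) / (t ^ 3 * T * (L * M))"
      if "T \<noteq> 0" "L \<noteq> 0" "M \<noteq> 0" for T L M c :: real
      using that \<open>0 < t\<close> by (simp add: divide_simps) (simp add: algebra_simps power2_eq_square power3_eq_cube power4_eq_xxxx)
    show "(0 * (t ^ (m + 2) * ln (D / t) ^ (m + 1)) - 1 * ((real m + 2) * t ^ (m + 1) * ln (D / t) ^ (m + 1)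
          + (real m + 1) * (- (1 / t) * ln (D / t) ^ m) * t ^ (m + 2)))
        / (t ^ (m + 2) * ln (D / t) ^ (m + 1) * (t ^ (m + 2) * ln (D / t) ^ (m + 1))) = Hardy_profile' D m t"
    proof -
      have e: "t ^ (m + 2) = t\<^sup>2 * t ^ m" "t ^ (m + 1) = t * t ^ m" "t ^ (m + 3) = t ^ 3 * t ^ m"
        "ln (D / t) ^ (m + 1) = ln (D / t) * ln (D / t) ^ m"
        "ln (D / t) ^ (m + 2) = (ln (D / t))\<^sup>2 * ln (D / t) ^ m"
        by (simp_all add: power_add power2_eq_square)
      have "2 + real m = real m + 2" by simp
      then show ?thesis
        unfolding Hardy_profile'_def e using alg[of "t ^ m" "ln (D / t)" "ln (D / t) ^ m" "real m + 1"] L \<open>0 < t\<close>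
        by (simp add: add.commute)
    qed
    show "t ^ (m + 2) * ln (D / t) ^ (m + 1) \<noteq> 0" using L \<open>0 < t\<close> by simp
  qed
qed

lemma continuous_on_Hardy_profile:
  assumes "\<And>t. t \<in> S \<Longrightarrow> 0 < t \<and> t < D"
  shows "continuous_on S (Hardy_profile D m)" "continuous_on S (Hardy_profile' D m)"
proof -
  have "t \<noteq> 0 \<and> 0 < D / t \<and> ln (D / t) > 0" if "t \<in> S" for t
    using assms[OF that] by simp
  then show "continuous_on S (Hardy_profile D m)" "continuous_on S (Hardy_profile' D m)"
    unfolding Hardy_profile_def Hardy_profile'_def by (force intro!: continuous_intros)+
qed

lemma Hardy_profile_nonneg: "0 < t \<Longrightarrow> t < D \<Longrightarrow> Hardy_profile D m t \<ge> 0"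
  by (simp add: Hardy_profile_def)

subsection \<open>The inequality for test functions\<close>

text \<open>All integrals live on the compact support of \<phi>. There the strict inequality
  \<open>infdist x K < D\<close> leaves a positive gap, so the profile and its derivative are
  bounded along the approximation and dominated convergence applies. Here \<open>c\<close> is
  \<bar>\<phi>\<bar> \<open>/ d\<close> times \<open>X (d / D)\<close>, and \<open>m + 2\<close>
  plays the role of \<open>k\<close>.\<close>

lemma Hardy_C1c_strict:
  fixes \<Omega> K :: "'a::euclidean_space set"
  assumes K: "closed K" "K \<noteq> {}" and "open \<Omega>"
    and A: "\<And>\<phi>. \<phi> \<in> C1c (\<Omega> - K) \<Longrightarrow> (\<And>x. \<phi> x \<ge> 0) \<Longrightarrow> A_fun \<Omega> K (m + 2) \<phi> \<ge> 0"
    and D: "\<And>x. x \<in> \<Omega> \<Longrightarrow> infdist x K < D"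
    and \<phi>: "\<phi> \<in> C1c (\<Omega> - K)"
  defines "l \<equiv> (real m + 1) / (real m + 2)"
  defines "c \<equiv> (\<lambda>x. \<bar>\<phi> x\<bar> / (infdist x K * ln (D / infdist x K)))"
  shows "integrable lborel (\<lambda>x. c x ^ (m + 2))"
    and "integrable lborel (\<lambda>x. norm (grad \<phi> x) ^ (m + 2))"
    and "l ^ (m + 2) * (LINT x|lborel. c x ^ (m + 2)) \<le> (LINT x|lborel. norm (grad \<phi> x) ^ (m + 2))"
proof -
  let ?d = "\<lambda>x. infdist x K"
  define S where "S = closure {x. \<phi> x \<noteq> 0}"
  have S: "compact S" "S \<subseteq> \<Omega> - K" and C1: "Ck_on 1 \<phi> UNIV"
    using \<phi> by (auto simp: C1c_def compactly_supported_in_def S_def)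
  have cS: "closed S" using S(1) by (rule compact_imp_closed)
  note G\<phi> = Ck_on_1_gradient(1)[OF C1] and c\<phi>' = Ck_on_1_gradient(2)[OF C1]
  have c\<phi>: "continuous_on UNIV \<phi>"
    using G\<phi> by (auto simp: continuous_on_eq_continuous_at gderiv_def intro: has_derivative_continuous)
  have cd: "continuous_on X ?d" for X by (intro continuous_intros)
  have \<phi>0: "\<phi> x = 0" if "x \<notin> S" for x
    using that closure_subset[of "{x. \<phi> x \<noteq> 0}"] by (auto simp: S_def)
  have out: "GDERIV f x :> 0" if "x \<notin> S" "\<And>y. y \<notin> S \<Longrightarrow> f y = 0" for f :: "'a \<Rightarrow> real" and x
  proof -
    have "((\<lambda>y. 0) has_derivative (\<lambda>h. h \<bullet> 0)) (at x)" by simp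
    then show ?thesis unfolding gderiv_def
      by (rule has_derivative_transform_within_open[OF _ open_Compl[OF cS]]) (use that in auto)
  qed
  have g\<phi>0: "grad \<phi> x = 0" if "x \<notin> S" for x
    by (intro grad_eqI out that \<phi>0)
  have dS: "0 < ?d x \<and> ?d x < D" if "x \<in> S" for x
    using that S(2) D[of x] infdist_pos_not_in_closed[OF K, of x] by blast
  \<comment> \<open>The margin is \<open>2 * \<eta>\<close> because one \<eta> is spent on replacing
    the distance by averages over balls of radius at most \<eta>; their values on \<open>S\<close>
    still lie in \<open>J = {\<eta>..D - \<eta>}\<close>.\<close>
  obtain \<eta> where \<eta>: "\<eta> > 0" "\<And>x. x \<in> S \<Longrightarrow> 2 * \<eta> \<le> ?d x \<and> ?d x \<le> D - 2 * \<eta>"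
  proof (cases "S = {}")
    case False
    obtain a where a: "a \<in> S" "\<And>x. x \<in> S \<Longrightarrow> ?d a \<le> ?d x"
      using continuous_attains_inf[OF S(1) False cd] by blast
    obtain b where b: "b \<in> S" "\<And>x. x \<in> S \<Longrightarrow> ?d x \<le> ?d b"
      using continuous_attains_sup[OF S(1) False cd] by blast
    show thesis
    proof (rule that[of "min (?d a) (D - ?d b) / 2"])
      show "min (?d a) (D - ?d b) / 2 > 0" using dS a(1) b(1) by simp
      show "2 * (min (?d a) (D - ?d b) / 2) \<le> ?d x \<and> ?d x \<le> D - 2 * (min (?d a) (D - ?d b) / 2)"
        if "x \<in> S" for x
        using a(2)[OF that] b(2)[OF that] by (simp add: min_def)
    qed
  qed (use that[of 1] in auto)
  define J where "J = {\<eta>..D - \<eta>}"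
  have J: "0 < t \<and> t < D" if "t \<in> J" for t using that \<eta>(1) by (auto simp: J_def)
  have dJ: "?d x \<in> J" if "x \<in> S" for x
    using \<eta>(2)[OF that] \<eta>(1) by (simp add: J_def)
  note ch = continuous_on_Hardy_profile(1)[of J D m, OF J] and ch' = continuous_on_Hardy_profile(2)[of J D m, OF J]
  have cJ: "compact J" by (simp add: J_def)
  obtain H where H: "H \<ge> 0" "\<And>t. t \<in> J \<Longrightarrow> norm (Hardy_profile D m t) \<le> H"
    using bounded_on_compact[OF cJ ch] by blast
  obtain H' where H': "H' \<ge> 0" "\<And>t. t \<in> J \<Longrightarrow> norm (Hardy_profile' D m t) \<le> H'"
    using bounded_on_compact[OF cJ ch'] by blast
  define F where "F x = \<bar>\<phi> x\<bar> ^ (m + 2)" for x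
  define gF where "gF x = ((real m + 2) * \<bar>\<phi> x\<bar> ^ m * \<phi> x) *\<^sub>R grad \<phi> x" for x
  have GF: "GDERIV F x :> gF x" for x
    unfolding F_def gF_def by (rule GDERIV_DERIV_compose[OF G\<phi> DERIV_abs_power])
  have cF: "continuous_on X F" and cgF: "continuous_on X gF" for X
    unfolding F_def gF_def
    by (auto intro!: continuous_intros continuous_on_subset[OF c\<phi>] continuous_on_subset[OF c\<phi>'])
  have F0: "F x = 0" "gF x = 0" if "x \<notin> S" for x
    using \<phi>0[OF that] by (auto simp: F_def gF_def)
  have F_nonneg: "F x \<ge> 0" for x by (simp add: F_def)
  obtain M where M: "M \<ge> 0" "\<And>x. x \<in> S \<Longrightarrow> norm (F x) \<le> M"
    using bounded_on_compact[OF S(1) cF] by blast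
  obtain M' where M': "M' \<ge> 0" "\<And>x. x \<in> S \<Longrightarrow> norm (gF x) \<le> M'"
    using bounded_on_compact[OF S(1) cgF] by blast
  obtain g where g: "g \<in> borel_measurable borel" "\<And>x. norm (g x) \<le> 1"
    "\<And>x. x \<in> ray_interior K \<Longrightarrow> GDERIV ?d x :> g x"
    by (rule borel_gradient_infdist[OF K]) blast
  define r where "r n = \<eta> * inverse (real (Suc n))" for n
  have r: "r n > 0" "r n \<le> \<eta>" for n using \<eta>(1) by (auto simp: r_def field_simps)
  have r0: "r \<longlonglongrightarrow> 0"
    unfolding r_def using tendsto_mult[OF tendsto_const LIMSEQ_inverse_real_of_nat, of \<eta>] by simp
  define b where "b n = ball_avg (r n) ?d" for n
  define gb where "gb n = ball_avg (r n) g" for n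
  have bd: "\<bar>b n x - ?d x\<bar> \<le> r n" for n x
    unfolding b_def by (intro ball_avg_Lipschitz r infdist_triangle_abs)
  have bJ: "b n x \<in> J" if "x \<in> S" for n x
    using \<eta>(2)[OF that] bd[of n x] r(2)[of n] by (auto simp: J_def abs_le_iff)
  have Gb: "GDERIV (b n) x :> gb n x" if "?d x > \<eta>" for n x
    unfolding b_def gb_def using that r(2)[of n]
    by (intro GDERIV_ball_avg[OF K g] r) auto
  have cgb: "continuous_on X (gb n)" for X n
    unfolding gb_def by (rule continuous_on_subset[OF continuous_on_ball_avg[OF g(1,2)]]) auto
  have gb1: "norm (gb n x) \<le> 1" for n x
    unfolding gb_def by (intro norm_ball_avg_le r g)
  define W where "W = {x. ?d x > \<eta>}"
  have W: "open W" unfolding W_def by (intro open_Collect_less continuous_intros)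
  have SW: "S \<subseteq> W"
  proof
    show "x \<in> W" if "x \<in> S" for x using \<eta>(1) \<eta>(2)[OF that] by (simp add: W_def)
  qed
  have cb: "continuous_on W (b n)" for n
    using Gb unfolding W_def gderiv_def
    by (auto simp: continuous_on_eq_continuous_at W[unfolded W_def] intro: has_derivative_continuous)
  \<comment> \<open>Off \<open>S\<close> the averages may reach or exceed \<open>D\<close>, where
    the profile is singular. Clamping them to \<open>J\<close> changes nothing on \<open>S\<close>,
    and off \<open>S\<close> the factors \<open>F\<close> and \<open>gF\<close> vanish; so the
    gradient of the test function can be recognised as continuous on the open neighbourhood
    \<open>W\<close> of \<open>S\<close>.\<close>
  define bt where "bt n x = max \<eta> (min (D - \<eta>) (b n x))" for n x
  have bt: "bt n x = b n x" if "x \<in> S" for n x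
    using bJ[OF that, of n] by (auto simp: bt_def J_def)
  have cbt: "continuous_on W (bt n)" for n
    unfolding bt_def by (intro continuous_intros cb)
  \<comment> \<open>If \<open>S\<close> is empty, \<open>J\<close> may be empty too; a point of
    \<open>S\<close> guarantees \<open>\<eta> \<le> D - \<eta>\<close>, without which clamping would
    not land in \<open>J\<close>.\<close>
  have btJ: "bt n x \<in> J" if "S \<noteq> {}" for n x
  proof -
    obtain s where "s \<in> S" using \<open>S \<noteq> {}\<close> by blast
    then have "\<eta> \<le> D - \<eta>" using \<eta>(2)[OF \<open>s \<in> S\<close>] \<eta>(1) by auto
    then show ?thesis by (auto simp: bt_def J_def)
  qed
  define \<psi> where "\<psi> n x = F x * Hardy_profile D m (b n x)" for n x
  define g\<psi> where "g\<psi> n x = F x *\<^sub>R (Hardy_profile' D m (b n x) *\<^sub>R gb n x) + Hardy_profile D m (b n x) *\<^sub>R gF x" for n x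
  have \<psi>0: "\<psi> n x = 0" "g\<psi> n x = 0" if "x \<notin> S" for n x
    using F0[OF that] by (auto simp: \<psi>_def g\<psi>_def)
  have G\<psi>: "GDERIV (\<psi> n) x :> g\<psi> n x" for n x
  proof (cases "x \<in> S")
    case True
    have "GDERIV (b n) x :> gb n x" using True SW by (intro Gb) (auto simp: W_def)
    moreover have "(Hardy_profile D m has_real_derivative Hardy_profile' D m (b n x)) (at (b n x))"
      using J[OF bJ[OF True]] by (intro DERIV_Hardy_profile) auto
    ultimately show ?thesis
      unfolding \<psi>_def g\<psi>_def by (intro GDERIV_mult GF GDERIV_DERIV_compose)
  next
    case False
    then show ?thesis using out[of x "\<psi> n"] \<psi>0 by simp
  qed
  have cg\<psi>: "continuous_on UNIV (g\<psi> n)" for n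
  proof -
    have "continuous_on W (g\<psi> n)"
    proof (cases "S = {}")
      case True
      then have "g\<psi> n = (\<lambda>x. 0)" using \<psi>0 by auto
      then show ?thesis by simp
    next
      case False
      have "continuous_on W (\<lambda>x. F x *\<^sub>R (Hardy_profile' D m (bt n x) *\<^sub>R gb n x) + Hardy_profile D m (bt n x) *\<^sub>R gF x)"
        using btJ[OF False]
        by (intro continuous_intros cF cgF cgb continuous_on_compose2[OF ch cbt] continuous_on_compose2[OF ch' cbt]) auto
      moreover have "g\<psi> n x = F x *\<^sub>R (Hardy_profile' D m (bt n x) *\<^sub>R gb n x) + Hardy_profile D m (bt n x) *\<^sub>R gF x" for x
        using F0[of x] bt[of x n] by (cases "x \<in> S") (auto simp: g\<psi>_def)
      ultimately show ?thesis by (simp cong: continuous_on_cong)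
    qed
    moreover have "continuous_on (- S) (g\<psi> n)"
    proof (rule continuous_on_eq)
      show "continuous_on (- S) (\<lambda>x. 0 :: 'a)" by simp
      show "0 = g\<psi> n x" if "x \<in> - S" for x using \<psi>0(2)[of x n] that by simp
    qed
    ultimately have "continuous_on (W \<union> - S) (g\<psi> n)"
      using W cS by (intro continuous_on_open_Un) auto
    moreover have "W \<union> - S = UNIV" using SW by auto
    ultimately show ?thesis by simp
  qed
  have c\<psi>: "continuous_on UNIV (\<psi> n)" for n
    using G\<psi> by (auto simp: continuous_on_eq_continuous_at gderiv_def intro: has_derivative_continuous)
  have \<psi>_nonneg: "\<psi> n x \<ge> 0" for n x
  proof (cases "x \<in> S")
    case True
    then show ?thesis using J[OF bJ[OF True]] F_nonneg Hardy_profile_nonneg by (auto simp: \<psi>_def)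
  qed (simp add: \<psi>0)
  have \<psi>C: "\<psi> n \<in> C1c (\<Omega> - K)" for n
  proof -
    have "{x. \<psi> n x \<noteq> 0} \<subseteq> S" using \<psi>0 by auto
    then have "closure {x. \<psi> n x \<noteq> 0} \<subseteq> S" using cS by (rule closure_minimal)
    moreover from this have "compact (closure {x. \<psi> n x \<noteq> 0})"
      using S(1) by (metis closed_closure compact_Int_closed inf.absorb_iff2)
    ultimately show ?thesis
      using Ck_on_1I[OF G\<psi> cg\<psi>] S(2) by (auto simp: C1c_def compactly_supported_in_def)
  qed
  have grad\<psi>: "grad (\<psi> n) = g\<psi> n" for n
    using grad_eqI[OF G\<psi>] by (simp add: fun_eq_iff)
  define P where "P n x = ?d x * (g x \<bullet> g\<psi> n x)" for n x
  have md: "?d \<in> borel_measurable borel" using cd by (rule borel_measurable_continuous_onI)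
  have mP: "P n \<in> borel_measurable borel" for n
    unfolding P_def using borel_measurable_continuous_onI[OF cg\<psi>] md g(1) by auto
  have bound_h: "norm (Hardy_profile D m (b n x)) \<le> H" "norm (Hardy_profile' D m (b n x)) \<le> H'" if "x \<in> S" for n x
    using H(2) H'(2) bJ[OF that] by auto
  have D0: "D \<ge> 0" if "x \<in> S" for x using dS[OF that] by simp
  have bP: "\<bar>P n x\<bar> \<le> D * (M * H' + H * M')" if x: "x \<in> S" for n x
  proof -
    have "norm (g\<psi> n x) \<le> norm (F x *\<^sub>R (Hardy_profile' D m (b n x) *\<^sub>R gb n x)) + norm (Hardy_profile D m (b n x) *\<^sub>R gF x)"
      unfolding g\<psi>_def by (rule norm_triangle_ineq)
    also have "\<dots> = norm (F x) * (norm (Hardy_profile' D m (b n x)) * norm (gb n x)) + norm (Hardy_profile D m (b n x)) * norm (gF x)"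
      by (simp only: norm_scaleR real_norm_def)
    also have "\<dots> \<le> M * (H' * 1) + H * M'"
      using M M' H H' bound_h[OF x] x gb1
      by (intro add_mono mult_mono) auto
    finally have 1: "norm (g\<psi> n x) \<le> M * H' + H * M'" by simp
    have "\<bar>P n x\<bar> \<le> ?d x * (norm (g x) * norm (g\<psi> n x))"
      unfolding P_def abs_mult by (simp add: infdist_nonneg Cauchy_Schwarz_ineq2 mult_left_mono)
    also have "\<dots> \<le> D * (1 * (M * H' + H * M'))"
      using dS[OF x] g(2)[of x] 1 by (intro mult_mono) auto
    finally show ?thesis by simp
  qed
  have P0: "P n x = 0" if "x \<notin> S" for n x using \<psi>0[OF that] by (simp add: P_def)
  have b\<psi>: "\<bar>\<psi> n x\<bar> \<le> M * H" if "x \<in> S" for n x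
    unfolding \<psi>_def abs_mult using M(1) M(2)[OF that] bound_h(1)[OF that, of n]
    by (intro mult_mono) auto
  have intP: "integrable lborel (P n)" for n
    by (rule integrable_bounded_compact_support[OF mP S(1) bP P0])
  have int\<psi>: "integrable lborel (\<psi> n)" for n
    by (rule integrable_bounded_compact_support[OF borel_measurable_continuous_onI[OF c\<psi>] S(1) b\<psi> \<psi>0(1)])
  \<comment> \<open>The integrand of \<open>A_fun\<close> at the test function with reversed sign,
    with the Borel version \<open>g\<close> in place of \<open>grad\<close>; the two agree almost
    everywhere on \<open>S\<close>. The hypothesis on \<open>A_fun\<close> thus says that the
    integral of \<open>Q n\<close> is at most 0.\<close>
  define Q where "Q n x = P n x + (real m + 2) * \<psi> n x" for n x
  have Qneg: "(LINT x|lborel. Q n x) \<le> 0" for n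
  proof -
    have ae: "AE x in lebesgue. x \<notin> K \<longrightarrow> x \<in> ray_interior K"
      using AE_ray_interior[OF K] by (rule AE_completion)
    let ?f = "\<lambda>x. indicator \<Omega> x *\<^sub>R (?d x * (grad ?d x \<bullet> grad (\<psi> n) x))"
    have eq: "AE x in lebesgue. P n x = ?f x"
      using ae
    proof eventually_elim
      case (elim x)
      show ?case
      proof (cases "x \<in> S")
        case True
        then have "x \<in> \<Omega>" "x \<in> ray_interior K" using S(2) elim by auto
        then show ?thesis by (simp add: P_def grad\<psi> grad_eqI[OF g(3)])
      qed (simp add: P0 grad\<psi> \<psi>0)
    qed
    have mPl: "P n \<in> borel_measurable lebesgue"
      using mP[of n] by (simp add: measurable_completion)
    have "(LINT x:\<Omega>|lebesgue. ?d x * (grad ?d x \<bullet> grad (\<psi> n) x)) = (LINT x|lebesgue. P n x)"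
      unfolding set_lebesgue_integral_def
      using borel_measurable_AE[OF mPl eq] mPl eq by (intro integral_cong_AE) auto
    also have "\<dots> = (LINT x|lborel. P n x)"
      using mP[of n] by (intro integral_completion) simp
    finally have 1: "(LINT x:\<Omega>|lebesgue. ?d x * (grad ?d x \<bullet> grad (\<psi> n) x)) = (LINT x|lborel. P n x)" .
    have "(LINT x:\<Omega>|lebesgue. \<psi> n x) = (LINT x|lebesgue. \<psi> n x)"
      unfolding set_lebesgue_integral_def using S(2) \<psi>0(1)
      by (intro Bochner_Integration.integral_cong) (auto simp: indicator_def)
    also have "\<dots> = (LINT x|lborel. \<psi> n x)"
      using borel_measurable_continuous_onI[OF c\<psi>] by (intro integral_completion) simp
    finally have 2: "(LINT x:\<Omega>|lebesgue. \<psi> n x) = (LINT x|lborel. \<psi> n x)" .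
    have "A_fun \<Omega> K (m + 2) (\<psi> n) \<ge> 0" by (rule A[OF \<psi>C \<psi>_nonneg])
    then have "(LINT x|lborel. P n x) + (real m + 2) * (LINT x|lborel. \<psi> n x) \<le> 0"
      unfolding A_fun_def 1 2 by (simp add: algebra_simps)
    also have "(LINT x|lborel. P n x) + (real m + 2) * (LINT x|lborel. \<psi> n x) = (LINT x|lborel. Q n x)"
      unfolding Q_def using intP int\<psi> by simp
    finally show ?thesis .
  qed
  \<comment> \<open>What \<open>Q n\<close> becomes when the averages are replaced by the distance
    itself and the product of \<open>g x\<close> with the averaged gradient by 1.\<close>
  define Q' where "Q' x = ?d x * (F x * Hardy_profile' D m (?d x) + Hardy_profile D m (?d x) * (g x \<bullet> gF x))
    + (real m + 2) * (F x * Hardy_profile D m (?d x))" for x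
  have Q'0: "Q' x = 0" if "x \<notin> S" for x using F0[OF that] by (simp add: Q'_def)
  have bd_lim: "(\<lambda>n. b n x) \<longlonglongrightarrow> ?d x" for x
  proof -
    have "(\<lambda>n. b n x - ?d x) \<longlonglongrightarrow> 0"
      by (rule tendsto_rabs_zero_cancel, rule tendsto_sandwich[OF _ _ tendsto_const r0]) (use bd in auto)
    then show ?thesis by (simp add: LIM_zero_iff)
  qed
  have Qlim: "AE x in lborel. (\<lambda>n. Q n x) \<longlonglongrightarrow> Q' x"
    using AE_ray_interior[OF K]
  proof eventually_elim
    case (elim x)
    show ?case
    proof (cases "x \<in> S")
      case True
      then have xr: "x \<in> ray_interior K" using S(2) elim by auto
      have l1: "(\<lambda>n. g x \<bullet> gb n x) \<longlonglongrightarrow> 1"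
        unfolding gb_def by (rule inner_ball_avg_gradient_tendsto[OF K g xr r(1) r0])
      have l2: "(\<lambda>n. Hardy_profile D m (b n x)) \<longlonglongrightarrow> Hardy_profile D m (?d x)"
        by (rule continuous_on_tendsto_compose[OF ch bd_lim]) (use dJ[OF True] bJ[OF True] in auto)
      have l3: "(\<lambda>n. Hardy_profile' D m (b n x)) \<longlonglongrightarrow> Hardy_profile' D m (?d x)"
        by (rule continuous_on_tendsto_compose[OF ch' bd_lim]) (use dJ[OF True] bJ[OF True] in auto)
      have "(\<lambda>n. ?d x * (F x * Hardy_profile' D m (b n x) * (g x \<bullet> gb n x) + Hardy_profile D m (b n x) * (g x \<bullet> gF x))
          + (real m + 2) * (F x * Hardy_profile D m (b n x)))
        \<longlonglongrightarrow> ?d x * (F x * Hardy_profile' D m (?d x) * 1 + Hardy_profile D m (?d x) * (g x \<bullet> gF x))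
          + (real m + 2) * (F x * Hardy_profile D m (?d x))"
        by (intro tendsto_intros l1 l2 l3)
      then show ?thesis
        by (simp add: Q_def Q'_def P_def g\<psi>_def \<psi>_def inner_add_right)
    qed (simp add: Q'0 Q_def P0 \<psi>0)
  qed
  \<comment> \<open>The bound does not depend on \<open>n\<close>; times the indicator of the
    compact set \<open>S\<close> it dominates every \<open>Q n\<close>.\<close>
  define B where "B = D * (M * H' + H * M') + (real m + 2) * (M * H)"
  have bQ: "\<bar>Q n x\<bar> \<le> B" if "x \<in> S" for n x
  proof -
    have "\<bar>Q n x\<bar> \<le> \<bar>P n x\<bar> + \<bar>(real m + 2) * \<psi> n x\<bar>" unfolding Q_def by (rule abs_triangle_ineq)
    also have "\<dots> = \<bar>P n x\<bar> + (real m + 2) * \<bar>\<psi> n x\<bar>" by (simp add: abs_mult)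
    also have "\<dots> \<le> B" unfolding B_def using bP[OF that] b\<psi>[OF that] by (intro add_mono mult_left_mono) auto
    finally show ?thesis .
  qed
  have Q0: "Q n x = 0" if "x \<notin> S" for n x using P0[OF that] \<psi>0[OF that] by (simp add: Q_def)
  have mQ: "Q n \<in> borel_measurable borel" for n
    unfolding Q_def using mP[of n] borel_measurable_continuous_onI[OF c\<psi>, of n] by auto
  have dc: "continuous_on S (\<lambda>x. Hardy_profile D m (?d x))" "continuous_on S (\<lambda>x. Hardy_profile' D m (?d x))"
    by (intro continuous_on_compose2[OF ch cd] continuous_on_compose2[OF ch' cd]; use dJ in auto)+
  have mS: "f \<in> borel_measurable borel"
    if "continuous_on S f" "\<And>x. x \<notin> S \<Longrightarrow> f x = 0" for f :: "'a \<Rightarrow> 'b::euclidean_space"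
  proof -
    have "(\<lambda>x. indicator S x *\<^sub>R f x) \<in> borel_measurable borel"
      using that(1) cS by (intro borel_measurable_continuous_on_indicator) auto
    also have "(\<lambda>x. indicator S x *\<^sub>R f x) = f" using that(2) by (fastforce simp: indicator_def)
    finally show ?thesis .
  qed
  have Q'_meas: "Q' \<in> borel_measurable borel"
  proof -
    have mF: "(\<lambda>x. F x * Hardy_profile' D m (?d x)) \<in> borel_measurable borel" "(\<lambda>x. F x * Hardy_profile D m (?d x)) \<in> borel_measurable borel"
      "(\<lambda>x. Hardy_profile D m (?d x) *\<^sub>R gF x) \<in> borel_measurable borel"
      using F0 by (auto intro!: mS continuous_intros dc cF cgF)
    have "Q' = (\<lambda>x. ?d x * (F x * Hardy_profile' D m (?d x) + g x \<bullet> (Hardy_profile D m (?d x) *\<^sub>R gF x))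
        + (real m + 2) * (F x * Hardy_profile D m (?d x)))"
      by (simp add: Q'_def fun_eq_iff)
    then show ?thesis
      by (simp only:) (intro borel_measurable_add borel_measurable_times[OF md]
        borel_measurable_times[OF borel_measurable_const] borel_measurable_inner mF g(1))
  qed
  have B_int: "integrable lborel (\<lambda>x. indicator S x * B)"
    using emeasure_compact_finite[OF S(1)] cS
    by (intro integrable_mult_left integrable_real_indicator) auto
  have B_bd: "AE x in lborel. norm (Q n x) \<le> indicator S x * B" for n
    using bQ Q0 by (intro AE_I2) (auto simp: indicator_def)
  have "(\<lambda>n. LINT x|lborel. Q n x) \<longlonglongrightarrow> (LINT x|lborel. Q' x)"
    using Q'_meas mQ by (intro integral_dominated_convergence[OF _ _ B_int Qlim B_bd]) auto
  then have Q'neg: "(LINT x|lborel. Q' x) \<le> 0"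
    by (rule LIMSEQ_le_const2) (use Qneg in auto)
  have intQ': "integrable lborel Q'"
    using Q'_meas mQ by (intro integrable_dominated_convergence[OF _ _ B_int Qlim B_bd]) auto
  have c_eq: "c x = \<bar>\<phi> x\<bar> / (?d x * ln (D / ?d x))" for x by (simp add: c_def)
  have L: "ln (D / ?d x) > 0" if "x \<in> S" for x using dS[OF that] by simp
  have c_nonneg: "c x \<ge> 0" if "x \<in> S" for x using L[OF that] infdist_nonneg[of x K] unfolding c_eq by (intro divide_nonneg_nonneg mult_nonneg_nonneg) auto
  have cc: "continuous_on S c"
    unfolding c_def using dS L
    by (intro continuous_intros continuous_on_subset[OF c\<phi>]) force+
  have c0: "c x = 0" if "x \<notin> S" for x using \<phi>0[OF that] by (simp add: c_eq)
  show intc: "integrable lborel (\<lambda>x. c x ^ (m + 2))"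
  proof -
    have ck: "continuous_on S (\<lambda>x. c x ^ (m + 2))" by (intro continuous_intros cc)
    obtain B where "\<And>x. x \<in> S \<Longrightarrow> norm (c x ^ (m + 2)) \<le> B"
      using bounded_on_compact[OF S(1) ck] by blast
    then show ?thesis
      using c0 by (intro integrable_bounded_compact_support[OF mS[OF ck] S(1)]) auto
  qed
  show intg: "integrable lborel (\<lambda>x. norm (grad \<phi> x) ^ (m + 2))"
  proof -
    have ck: "continuous_on S (\<lambda>x. norm (grad \<phi> x) ^ (m + 2))"
      by (intro continuous_intros continuous_on_subset[OF c\<phi>']) auto
    obtain B where "\<And>x. x \<in> S \<Longrightarrow> norm (norm (grad \<phi> x) ^ (m + 2)) \<le> B"
      using bounded_on_compact[OF S(1) ck] by blast
    then show ?thesis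
      using g\<phi>0 by (intro integrable_bounded_compact_support[OF mS[OF ck] S(1)]) auto
  qed
  \<comment> \<open>The second identity expresses that \<open>l\<close> is the optimal parameter:
    after absorption exactly the factor \<open>l\<close> remains in front of the power of
    \<open>c\<close>.\<close>
  have l: "0 < l" "(real m + 1) * (1 - l) = l"
    unfolding l_def by (auto simp: field_simps)
  have low: "l * c x ^ (m + 2) - norm (grad \<phi> x) ^ (m + 2) / l ^ (m + 1) \<le> Q' x" for x
  proof (cases "x \<in> S")
    case False
    then show ?thesis by (simp add: c0 g\<phi>0 Q'0)
  next
    case True
    define \<delta> \<Lambda> where "\<delta> = ?d x" and "\<Lambda> = ln (D / ?d x)"
    have pos: "\<delta> > 0" "\<Lambda> > 0" using dS[OF True] L[OF True] by (auto simp: \<delta>_def \<Lambda>_def)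
    have hb: "Hardy_profile D m (?d x) = 1 / (\<delta> ^ (m + 2) * \<Lambda> ^ (m + 1))"
      "Hardy_profile' D m (?d x) = (real m + 1) / (\<delta> ^ (m + 3) * \<Lambda> ^ (m + 2)) - (real m + 2) / (\<delta> ^ (m + 3) * \<Lambda> ^ (m + 1))"
      by (simp_all add: Hardy_profile_def Hardy_profile'_def \<delta>_def \<Lambda>_def)
    have d3: "\<delta> ^ (m + 3) = \<delta> * \<delta> ^ (m + 2)" by (simp add: eval_nat_numeral)
    have cx: "c x = \<bar>\<phi> x\<bar> / (\<delta> * \<Lambda>)" by (simp add: c_eq \<delta>_def \<Lambda>_def)
    have "\<delta> * Hardy_profile' D m (?d x) + (real m + 2) * Hardy_profile D m (?d x) = (real m + 1) / (\<delta> ^ (m + 2) * \<Lambda> ^ (m + 2))"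
      unfolding hb d3 using pos by (simp add: right_diff_distrib)
    note e1 = this
    have "?d x * (F x * Hardy_profile' D m (?d x)) + (real m + 2) * (F x * Hardy_profile D m (?d x))
        = F x * (\<delta> * Hardy_profile' D m (?d x) + (real m + 2) * Hardy_profile D m (?d x))"
      by (simp add: \<delta>_def algebra_simps)
    also have "\<dots> = (real m + 1) * c x ^ (m + 2)"
      unfolding e1 cx F_def by (simp only: power_divide power_mult_distrib) simp
    finally have 1: "?d x * (F x * Hardy_profile' D m (?d x)) + (real m + 2) * (F x * Hardy_profile D m (?d x)) = (real m + 1) * c x ^ (m + 2)" .
    have "norm (gF x) = (real m + 2) * \<bar>\<phi> x\<bar> ^ (m + 1) * norm (grad \<phi> x)"
      by (simp add: gF_def abs_mult power_abs)
    moreover have "\<bar>g x \<bullet> gF x\<bar> \<le> norm (gF x)"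
      using Cauchy_Schwarz_ineq2[of "g x" "gF x"] mult_right_mono[OF g(2)[of x] norm_ge_zero[of "gF x"]] by simp
    ultimately have "- (g x \<bullet> gF x) \<le> (real m + 2) * \<bar>\<phi> x\<bar> ^ (m + 1) * norm (grad \<phi> x)" by simp
    then have "?d x * Hardy_profile D m (?d x) * - (g x \<bullet> gF x)
        \<le> ?d x * Hardy_profile D m (?d x) * ((real m + 2) * \<bar>\<phi> x\<bar> ^ (m + 1) * norm (grad \<phi> x))"
      using Hardy_profile_nonneg[of "?d x" D m] dS[OF True] by (intro mult_left_mono) auto
    also have e3: "?d x * Hardy_profile D m (?d x) = 1 / (\<delta> * \<Lambda>) ^ (m + 1)"
    proof -
      have "?d x * Hardy_profile D m (?d x) = \<delta> * (1 / (\<delta> ^ (m + 2) * \<Lambda> ^ (m + 1)))"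
        using hb(1) by (simp add: \<delta>_def)
      also have "\<dots> = 1 / (\<delta> * \<Lambda>) ^ (m + 1)" using pos by (simp add: power_mult_distrib)
      finally show ?thesis .
    qed
    also have "1 / (\<delta> * \<Lambda>) ^ (m + 1) * ((real m + 2) * \<bar>\<phi> x\<bar> ^ (m + 1) * norm (grad \<phi> x))
        = (real m + 2) * c x ^ (m + 1) * norm (grad \<phi> x)"
      unfolding cx power_divide by simp
    \<comment> \<open>Young with exponent \<open>m + 2\<close>. The term with \<open>c\<close> will
      be absorbed by \<open>(real m + 1) * c x ^ (m + 2)\<close> from fact \<open>1\<close>, the
      other one is the gradient term of the claim.\<close>
    also have "\<dots> \<le> (real m + 1) * l * c x ^ (m + 2) + norm (grad \<phi> x) ^ (m + 2) / l ^ (m + 1)"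
      using Young_power[of "norm (grad \<phi> x)" "c x" l "m + 1"] c_nonneg[OF True] l(1) by (simp add: ac_simps)
    finally have 2: "?d x * Hardy_profile D m (?d x) * - (g x \<bullet> gF x)
        \<le> (real m + 1) * l * c x ^ (m + 2) + norm (grad \<phi> x) ^ (m + 2) / l ^ (m + 1)"
      unfolding e3 by simp
    have "Q' x = (real m + 1) * c x ^ (m + 2) - ?d x * Hardy_profile D m (?d x) * - (g x \<bullet> gF x)"
      unfolding 1[symmetric] Q'_def by (simp add: algebra_simps)
    then have "(real m + 1) * (1 - l) * c x ^ (m + 2) - norm (grad \<phi> x) ^ (m + 2) / l ^ (m + 1) \<le> Q' x"
      using 2 by (simp add: algebra_simps)
    then show ?thesis unfolding l(2) .
  qed
  have "(LINT x|lborel. l * c x ^ (m + 2) - norm (grad \<phi> x) ^ (m + 2) / l ^ (m + 1)) \<le> (LINT x|lborel. Q' x)"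
    using intc intg intQ' low by (intro integral_mono) auto
  also have "\<dots> \<le> 0" by (rule Q'neg)
  also have "(LINT x|lborel. l * c x ^ (m + 2) - norm (grad \<phi> x) ^ (m + 2) / l ^ (m + 1))
      = l * (LINT x|lborel. c x ^ (m + 2)) - (LINT x|lborel. norm (grad \<phi> x) ^ (m + 2)) / l ^ (m + 1)"
    using intc intg by simp
  finally have "l * (LINT x|lborel. c x ^ (m + 2)) \<le> (LINT x|lborel. norm (grad \<phi> x) ^ (m + 2)) / l ^ (m + 1)"
    by simp
  then show "l ^ (m + 2) * (LINT x|lborel. c x ^ (m + 2)) \<le> (LINT x|lborel. norm (grad \<phi> x) ^ (m + 2))"
    using l(1) by (simp add: pos_le_divide_eq mult.commute mult.left_commute)
qed

subsection \<open>Smooth bumps and uniqueness of the weak gradient\<close>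

text \<open>The family is closed under differentiation up to linear combinations; the parameter \<open>c\<close> makes
  products of such functions increase to the indicator of a box as \<open>c\<close> tends to \<open>0\<close>.\<close>

definition flat :: "real \<Rightarrow> nat \<Rightarrow> real \<Rightarrow> real" where
  "flat c j t = (if t > 0 then exp (- c / t) / t ^ j else 0)"

text \<open>Substituting \<open>s = c / h\<close> turns this into the decay of
  \<open>s ^ n / exp s\<close> as \<open>s\<close> tends to infinity.\<close>

lemma tendsto_flat_0:
  fixes c :: real
  assumes "c > 0"
  shows "((\<lambda>h. exp (- c / h) / h ^ n) \<longlongrightarrow> 0) (at_right 0)"
proof -
  have "filterlim (\<lambda>h. c * inverse h) at_top (at_right 0)"
    by (intro filterlim_tendsto_pos_mult_at_top[OF tendsto_const] assms filterlim_inverse_at_top_right)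
  then have "((\<lambda>h. (c * inverse h) ^ n / exp (c * inverse h)) \<longlongrightarrow> 0) (at_right 0)"
    by (rule filterlim_compose[OF tendsto_power_div_exp_0])
  then have "((\<lambda>h. (c * inverse h) ^ n / exp (c * inverse h) / c ^ n) \<longlongrightarrow> 0 / c ^ n) (at_right 0)"
    using assms by (intro tendsto_intros) auto
  moreover have "(c * inverse h) ^ n / exp (c * inverse h) / c ^ n = exp (- c / h) / h ^ n" for h
    using assms by (simp add: power_mult_distrib exp_minus divide_inverse power_inverse)
  ultimately show ?thesis by simp
qed

lemma DERIV_flat:
  assumes "c > 0"
  shows "(flat c j has_real_derivative c * flat c (j + 2) t - real j * flat c (j + 1) t) (at t)"
proof (cases t "0 :: real" rule: linorder_cases)
  case greater
  have "((\<lambda>t. - c / t) has_real_derivative c / t\<^sup>2) (at t)"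
    using greater by (auto intro!: derivative_eq_intros simp: power2_eq_square)
  then have e: "((\<lambda>t. exp (- c / t)) has_real_derivative exp (- c / t) * (c / t\<^sup>2)) (at t)"
    by (rule DERIV_fun_exp)
  have p: "((\<lambda>t. t ^ j) has_real_derivative real j * t ^ j / t) (at t)"
    using DERIV_pow[of j t UNIV] greater by (cases j) auto
  have alg: "(E * (c / t\<^sup>2) * T - E * (n * T / t)) / (T * T) = c * (E / (T * t\<^sup>2)) - n * (E / (T * t))"
    if "T \<noteq> 0" for E T n
    using that greater by (simp add: field_simps power2_eq_square)
  have "((\<lambda>t. exp (- c / t) / t ^ j) has_real_derivative
      c * flat c (j + 2) t - real j * flat c (j + 1) t) (at t)"
  proof (rule DERIV_cong[OF DERIV_divide[OF e p]])
    show "(exp (- c / t) * (c / t\<^sup>2) * t ^ j - exp (- c / t) * (real j * t ^ j / t)) / (t ^ j * t ^ j)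
        = c * flat c (j + 2) t - real j * flat c (j + 1) t"
      using alg[of "t ^ j"] greater unfolding flat_def power_add by simp
  qed (use greater in auto)
  then show ?thesis
    by (rule has_field_derivative_transform_within_open[where S = "{0<..}"]) (use greater in \<open>auto simp: flat_def\<close>)
next
  case less
  have "((\<lambda>t. 0) has_real_derivative c * flat c (j + 2) t - real j * flat c (j + 1) t) (at t)"
    using less by (simp add: flat_def)
  then show ?thesis
    by (rule has_field_derivative_transform_within_open[where S = "{..<0}"]) (use less in \<open>auto simp: flat_def\<close>)
next
  case equal
  have "((\<lambda>h. flat c j h / h) \<longlongrightarrow> 0) (at_right 0)"
    by (rule Lim_transform_eventually[OF tendsto_flat_0[OF assms, of "Suc j"]])
      (auto simp: flat_def eventually_at_filter)
  moreover have "((\<lambda>h. flat c j h / h) \<longlongrightarrow> 0) (at_left 0)"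
    by (rule Lim_transform_eventually[OF tendsto_const]) (auto simp: flat_def eventually_at_filter)
  ultimately have "((\<lambda>h. flat c j h / h) \<longlongrightarrow> 0) (at 0)" by (simp add: filterlim_split_at)
  then show ?thesis by (simp add: equal has_field_derivative_iff flat_def)
qed

text \<open>A class of functions whose directional derivatives belong to it again, so that
  smoothness follows by induction on the order without any explicit formula for higher
  derivatives.\<close>

inductive flat_generated :: "('a::euclidean_space \<Rightarrow> real) \<Rightarrow> bool" where
  const: "flat_generated (\<lambda>x. a)"
| inner: "flat_generated (\<lambda>x. x \<bullet> v)"
| flat: "flat_generated f \<Longrightarrow> c > 0 \<Longrightarrow> flat_generated (\<lambda>x. flat c j (f x))"
| add: "flat_generated f \<Longrightarrow> flat_generated g \<Longrightarrow> flat_generated (\<lambda>x. f x + g x)"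
| mult: "flat_generated f \<Longrightarrow> flat_generated g \<Longrightarrow> flat_generated (\<lambda>x. f x * g x)"

lemma flat_generated_derivative:
  fixes f :: "'a::euclidean_space \<Rightarrow> real"
  assumes "flat_generated f"
  shows "\<exists>f'. (\<forall>v. flat_generated (f' v)) \<and> (\<forall>x. (f has_derivative (\<lambda>v. f' v x)) (at x))"
  using assms
proof induction
  case (const a)
  show ?case by (intro exI[of _ "\<lambda>v x. 0"]) (auto intro: flat_generated.const)
next
  case (inner w)
  show ?case
    by (intro exI[of _ "\<lambda>v x. v \<bullet> w"]) (auto intro: flat_generated.const intro!: derivative_eq_intros)
next
  case (flat f c j)
  then obtain f' where f': "\<And>v. flat_generated (f' v)" "\<And>x. (f has_derivative (\<lambda>v. f' v x)) (at x)" by blast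
  have "((\<lambda>x. flat c j (f x)) has_derivative
      (\<lambda>v. (c * flat c (j + 2) (f x) + - real j * flat c (j + 1) (f x)) * f' v x)) (at x)" for x
    using has_derivative_compose[OF f'(2) DERIV_flat[OF flat(2), unfolded has_field_derivative_def]]
    by simp
  moreover have "flat_generated (\<lambda>x. (c * flat c (j + 2) (f x) + - real j * flat c (j + 1) (f x)) * f' v x)" for v
    by (intro flat_generated.intros flat f')
  ultimately show ?case
    by (intro exI[of _ "\<lambda>v x. (c * flat c (j + 2) (f x) + - real j * flat c (j + 1) (f x)) * f' v x"]) blast
next
  case (add f g)
  then obtain f' g' where "\<And>v. flat_generated (f' v)" "\<And>x. (f has_derivative (\<lambda>v. f' v x)) (at x)"
    "\<And>v. flat_generated (g' v)" "\<And>x. (g has_derivative (\<lambda>v. g' v x)) (at x)" by blast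
  then show ?case
    by (intro exI[of _ "\<lambda>v x. f' v x + g' v x"]) (auto intro: flat_generated.add has_derivative_add)
next
  case (mult f g)
  then obtain f' g' where *: "\<And>v. flat_generated (f' v)" "\<And>x. (f has_derivative (\<lambda>v. f' v x)) (at x)"
    "\<And>v. flat_generated (g' v)" "\<And>x. (g has_derivative (\<lambda>v. g' v x)) (at x)" by blast
  have "flat_generated (\<lambda>x. f x * g' v x + f' v x * g x)" for v
    by (intro flat_generated.intros * mult)
  with * show ?case
    by (intro exI[of _ "\<lambda>v x. f x * g' v x + f' v x * g x"]) (auto intro: has_derivative_mult)
qed

lemma smooth_on_flat_generated:
  fixes f :: "'a::euclidean_space \<Rightarrow> real"
  assumes "flat_generated f"
  shows "smooth_on UNIV f"
proof -
  have "Ck_on n f UNIV" for n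
    using assms
  proof (induction n arbitrary: f)
    case 0
    then obtain f' where "\<And>x. (f has_derivative (\<lambda>v. f' v x)) (at x)"
      using flat_generated_derivative by blast
    then show ?case
      by (auto simp: continuous_on_eq_continuous_at intro: has_derivative_continuous)
  next
    case (Suc n)
    then obtain f' where f': "\<And>v. flat_generated (f' v)" "\<And>x. (f has_derivative (\<lambda>v. f' v x)) (at x)"
      using flat_generated_derivative by blast
    have "frechet_derivative f (at x) v = f' v x" for x v
      using frechet_derivative_at[OF f'(2)] by metis
    moreover have "f differentiable_on UNIV"
      using f'(2) unfolding differentiable_on_def differentiable_def by blast
    ultimately show ?case using Suc.IH[OF f'(1)] by simp
  qed
  then show ?thesis by (simp add: smooth_on_def)
qed

text \<open>When \<open>a \<bullet> i < b \<bullet> i\<close> for all \<open>i\<close>, the two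
  differences in a factor cannot both be negative, so their product is positive exactly where that
  coordinate is strictly inside its interval. The bump is then positive on the open box and 0
  elsewhere.\<close>

definition box_bump :: "'a::euclidean_space \<Rightarrow> 'a \<Rightarrow> real \<Rightarrow> 'a \<Rightarrow> real" where
  "box_bump a b c x = (\<Prod>i\<in>Basis. flat c 0 ((x \<bullet> i - a \<bullet> i) * (b \<bullet> i - x \<bullet> i)))"

lemma flat_generated_box_bump:
  assumes "c > 0"
  shows "flat_generated (box_bump a b c)"
proof -
  have "flat_generated (\<lambda>x. \<Prod>i\<in>I. flat c 0 ((x \<bullet> i - a \<bullet> i) * (b \<bullet> i - x \<bullet> i)))" if "finite I" for I
    using that
  proof induction
    case empty
    show ?case by (simp add: flat_generated.const)
  next
    case (insert i I)
    have "flat_generated (\<lambda>x. flat c 0 ((x \<bullet> i + - (a \<bullet> i)) * (b \<bullet> i + (-1) * (x \<bullet> i))))"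
      by (intro flat_generated.intros assms)
    then show ?case using insert by (simp add: flat_generated.mult)
  qed
  from this[OF finite_Basis] show ?thesis by (simp add: box_bump_def[abs_def])
qed

lemma box_bump_outside:
  assumes "\<And>i. i \<in> Basis \<Longrightarrow> a \<bullet> i < b \<bullet> i" "x \<notin> box a b"
  shows "box_bump a b c x = 0"
proof -
  obtain i where i: "i \<in> Basis" "\<not> (a \<bullet> i < x \<bullet> i \<and> x \<bullet> i < b \<bullet> i)"
    using assms(2) by (auto simp: mem_box)
  have "\<not> (x \<bullet> i - a \<bullet> i) * (b \<bullet> i - x \<bullet> i) > 0"
    using i(2) assms(1)[OF i(1)] by (auto simp: zero_less_mult_iff)
  then have "flat c 0 ((x \<bullet> i - a \<bullet> i) * (b \<bullet> i - x \<bullet> i)) = 0" by (simp add: flat_def)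
  then show ?thesis unfolding box_bump_def using i(1) by (meson finite_Basis prod_zero)
qed

lemma box_bump_bounds:
  assumes "c > 0"
  shows "0 \<le> box_bump a b c x" "box_bump a b c x \<le> 1"
proof -
  have "0 \<le> flat c 0 t \<and> flat c 0 t \<le> 1" for t using assms by (auto simp: flat_def)
  then show "0 \<le> box_bump a b c x" "box_bump a b c x \<le> 1"
    unfolding box_bump_def by (auto intro: prod_nonneg prod_le_1)
qed

lemma box_bump_tendsto:
  assumes "x \<in> box a b"
  shows "(\<lambda>n. box_bump a b (inverse (real (Suc n))) x) \<longlonglongrightarrow> 1"
proof -
  have "(\<lambda>n. flat (inverse (real (Suc n))) 0 t) \<longlonglongrightarrow> 1" if "t > 0" for t
  proof -
    have "(\<lambda>n. exp (- inverse (real (Suc n)) / t)) \<longlonglongrightarrow> exp (- 0 / t)"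
      using that by (intro tendsto_intros LIMSEQ_inverse_real_of_nat) auto
    then show ?thesis using that by (simp add: flat_def)
  qed
  then have "(\<lambda>n. box_bump a b (inverse (real (Suc n))) x) \<longlonglongrightarrow> (\<Prod>i\<in>(Basis :: 'a set). 1)"
    unfolding box_bump_def using assms by (intro tendsto_prod) (auto simp: mem_box)
  then show ?thesis by simp
qed

lemma box_bump_Cinfc:
  assumes "c > 0" "cbox a b \<subseteq> U" "\<And>i. i \<in> Basis \<Longrightarrow> a \<bullet> i < b \<bullet> i"
  shows "box_bump a b c \<in> Cinfc U"
proof -
  have "{x. box_bump a b c x \<noteq> 0} \<subseteq> cbox a b"
    using box_bump_outside[OF assms(3)] box_subset_cbox by blast
  then have "closure {x. box_bump a b c x \<noteq> 0} \<subseteq> cbox a b"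
    by (simp add: closure_minimal closed_cbox)
  moreover from this have "compact (closure {x. box_bump a b c x \<noteq> 0})"
    by (meson bounded_cbox bounded_subset closed_closure compact_eq_bounded_closed)
  ultimately show ?thesis
    using smooth_on_flat_generated[OF flat_generated_box_bump[OF assms(1)]] assms(2)
    by (auto simp: Cinfc_def compactly_supported_in_def)
qed

section \<open>Locally integrable functions that annihilate all test functions vanish almost
  everywhere\<close>

lemma set_integral_box_eq_0:
  fixes H :: "'a::euclidean_space \<Rightarrow> real"
  assumes H: "loc_integrable U H"
    and 0: "\<And>\<phi>. \<phi> \<in> Cinfc U \<Longrightarrow> (LINT x:U|lebesgue. H x * \<phi> x) = 0"
    and ab: "cbox a b \<subseteq> U"
  shows "(LINT x:box a b|lebesgue. H x) = 0"
proof (cases "\<forall>i\<in>Basis. a \<bullet> i < b \<bullet> i")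
  case False
  then have "box a b = {}" by (auto simp: box_eq_empty not_less)
  then show ?thesis by (simp add: set_lebesgue_integral_def)
next
  case True
  define \<phi> where "\<phi> n = box_bump a b (inverse (real (Suc n)))" for n
  have \<phi>: "\<phi> n \<in> Cinfc U" for n
    unfolding \<phi>_def by (intro box_bump_Cinfc ab) (use True in auto)
  have \<phi>_le: "\<bar>\<phi> n x\<bar> \<le> 1" for n x
    unfolding \<phi>_def using box_bump_bounds[of "inverse (real (Suc n))" a b x] by simp
  have \<phi>_out: "\<phi> n x = 0" if "x \<notin> box a b" for n x
    unfolding \<phi>_def by (rule box_bump_outside) (use True that in auto)
  have \<phi>_lim: "(\<lambda>n. \<phi> n x) \<longlonglongrightarrow> 1" if "x \<in> box a b" for x
    unfolding \<phi>_def using that by (rule box_bump_tendsto)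
  have int: "integrable lebesgue (\<lambda>x. indicator (cbox a b) x *\<^sub>R H x)"
    using H ab by (simp add: loc_integrable_def set_integrable_def)
  have "(\<lambda>x. indicator (box a b) x *\<^sub>R (indicator (cbox a b) x *\<^sub>R H x)) \<in> borel_measurable lebesgue"
    by (intro borel_measurable_scaleR[OF borel_measurable_indicator borel_measurable_integrable[OF int]]) simp
  also have "(\<lambda>x. indicator (box a b) x *\<^sub>R (indicator (cbox a b) x *\<^sub>R H x)) = (\<lambda>x. indicator (box a b) x *\<^sub>R H x)"
    using box_subset_cbox[of a b] by (auto simp: indicator_def fun_eq_iff)
  finally have m: "(\<lambda>x. indicator (box a b) x *\<^sub>R H x) \<in> borel_measurable lebesgue" .
  have m\<phi>: "\<phi> n \<in> borel_measurable lebesgue" for n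
  proof -
    have "continuous_on UNIV (\<phi> n)"
      using \<phi>[of n] by (auto simp: Cinfc_def smooth_on_def dest: spec[of _ 0])
    then show ?thesis by (intro measurable_completion) (simp add: borel_measurable_continuous_onI)
  qed
  \<comment> \<open>The bumps are bounded by 1 and tend to 1 on the open box, so the integrable
    function \<bar>\<open>H\<close>\<bar> on the closed box dominates. Every term is an integral
    against a test function and hence 0.\<close>
  have "(\<lambda>n. LINT x|lebesgue. (indicator (box a b) x *\<^sub>R H x) * \<phi> n x)
      \<longlonglongrightarrow> (LINT x|lebesgue. indicator (box a b) x *\<^sub>R H x)"
  proof (rule integral_dominated_convergence[where w = "\<lambda>x. \<bar>indicator (cbox a b) x *\<^sub>R H x\<bar>"])
    show "integrable lebesgue (\<lambda>x. \<bar>indicator (cbox a b) x *\<^sub>R H x\<bar>)" using int by (rule integrable_abs)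
    show "AE x in lebesgue. (\<lambda>n. (indicator (box a b) x *\<^sub>R H x) * \<phi> n x) \<longlonglongrightarrow> indicator (box a b) x *\<^sub>R H x"
    proof (rule AE_I2)
      fix x
      have "(\<lambda>n. (indicator (box a b) x *\<^sub>R H x) * \<phi> n x) \<longlonglongrightarrow> (indicator (box a b) x *\<^sub>R H x) * 1"
      proof (cases "x \<in> box a b")
        case True
        then show ?thesis by (intro tendsto_intros \<phi>_lim)
      qed simp
      then show "(\<lambda>n. (indicator (box a b) x *\<^sub>R H x) * \<phi> n x) \<longlonglongrightarrow> indicator (box a b) x *\<^sub>R H x" by simp
    qed
    show "AE x in lebesgue. norm ((indicator (box a b) x *\<^sub>R H x) * \<phi> n x) \<le> \<bar>indicator (cbox a b) x *\<^sub>R H x\<bar>" for n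
    proof (rule AE_I2)
      fix x
      have "\<bar>H x * \<phi> n x\<bar> \<le> \<bar>H x\<bar>"
        using mult_left_mono[OF \<phi>_le[of n x], of "\<bar>H x\<bar>"] by (simp add: abs_mult)
      then show "norm ((indicator (box a b) x *\<^sub>R H x) * \<phi> n x) \<le> \<bar>indicator (cbox a b) x *\<^sub>R H x\<bar>"
        using box_subset_cbox[of a b] by (auto simp: indicator_def)
    qed
  qed (use m m\<phi> in auto)
  moreover have "(LINT x|lebesgue. (indicator (box a b) x *\<^sub>R H x) * \<phi> n x) = 0" for n
  proof -
    have "(\<lambda>x. (indicator (box a b) x *\<^sub>R H x) * \<phi> n x) = (\<lambda>x. indicator U x *\<^sub>R (H x * \<phi> n x))"
    proof
      show "(indicator (box a b) x *\<^sub>R H x) * \<phi> n x = indicator U x *\<^sub>R (H x * \<phi> n x)" for x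
        using \<phi>_out[of x n] ab box_subset_cbox[of a b] by (auto simp: indicator_def)
    qed
    then show ?thesis using 0[OF \<phi>[of n]] by (simp only: set_lebesgue_integral_def)
  qed
  ultimately show ?thesis by (simp add: set_lebesgue_integral_def LIMSEQ_const_iff)
qed

text \<open>Open boxes form an intersection-stable generator of the Borel sets, so vanishing
  integrals over boxes spread to all Borel sets, and a function with this property is 0 almost
  everywhere. The argument runs on a Borel function \<open>g\<close> that agrees almost everywhere
  with \<open>H\<close> cut off to the box.\<close>

lemma AE_eq_0_box:
  fixes H :: "'a::euclidean_space \<Rightarrow> real"
  assumes H: "loc_integrable U H"
    and 0: "\<And>\<phi>. \<phi> \<in> Cinfc U \<Longrightarrow> (LINT x:U|lebesgue. H x * \<phi> x) = 0"
    and ab: "cbox a b \<subseteq> U"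
  shows "AE x in lborel. x \<in> box a b \<longrightarrow> H x = 0"
proof -
  define f where "f x = indicator (box a b) x *\<^sub>R H x" for x
  have "set_integrable lebesgue (cbox a b) H" using H ab by (simp add: loc_integrable_def)
  then have "set_integrable lebesgue (box a b) H"
    by (rule set_integrable_subset) (auto simp: box_subset_cbox)
  then have f: "integrable lebesgue f" by (simp add: set_integrable_def f_def[abs_def])
  then obtain g where g: "g \<in> borel_measurable lborel" "AE x in lborel. f x = g x"
    using completion_ex_borel_measurable_real[of f lborel] by auto
  have gl: "g \<in> borel_measurable lebesgue" using g(1) by (rule measurable_completion)
  have fg: "AE x in lebesgue. f x = g x" using g(2) by (rule AE_completion)
  have "integrable lebesgue g" using f fg gl by (subst integrable_cong_AE[of g _ f]) auto
  then have gint: "integrable lborel g" using g(1) by (simp add: integrable_completion)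
  have gA: "(LINT x:A|lborel. g x) = (LINT x:A|lebesgue. f x)" if "A \<in> sets borel" for A
  proof -
    have "(LINT x:A|lborel. g x) = (LINT x|lebesgue. indicator A x *\<^sub>R g x)"
      unfolding set_lebesgue_integral_def using g(1) that by (intro integral_completion[symmetric]) auto
    also have "\<dots> = (LINT x|lebesgue. indicator A x *\<^sub>R f x)"
    proof (rule integral_cong_AE)
      have A: "A \<in> sets lebesgue" using that by auto
      show "(\<lambda>x. indicator A x *\<^sub>R g x) \<in> borel_measurable lebesgue"
        "(\<lambda>x. indicator A x *\<^sub>R f x) \<in> borel_measurable lebesgue"
        by (intro borel_measurable_scaleR borel_measurable_indicator A gl borel_measurable_integrable[OF f])+
      show "AE x in lebesgue. indicator A x *\<^sub>R g x = indicator A x *\<^sub>R f x"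
        using fg by eventually_elim simp
    qed
    finally show ?thesis by (simp add: set_lebesgue_integral_def)
  qed
  have box0: "(LINT x:box l h|lborel. g x) = 0" for l h
  proof -
    \<comment> \<open>The corners of the intersection with \<open>box a b\<close>: an arbitrary box
      is thereby cut down to one whose closed box lies in \<open>U\<close>.\<close>
    define l' h' where "l' = (\<Sum>i\<in>Basis. max (a \<bullet> i) (l \<bullet> i) *\<^sub>R i)" and "h' = (\<Sum>i\<in>Basis. min (b \<bullet> i) (h \<bullet> i) *\<^sub>R i)"
    have eq: "box l h \<inter> box a b = box l' h'"
      by (subst Int_commute) (simp add: box_Int_box l'_def h'_def)
    have sub: "cbox l' h' \<subseteq> cbox a b"
      by (auto simp: mem_box l'_def h'_def)
    have "(LINT x:box l h|lebesgue. f x) = (LINT x:box l' h'|lebesgue. H x)"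
      unfolding set_lebesgue_integral_def eq[symmetric] f_def
      by (intro Bochner_Integration.integral_cong) (auto simp: indicator_def)
    also have "\<dots> = 0" using sub ab by (intro set_integral_box_eq_0[OF H 0]) auto
    finally show ?thesis by (simp add: gA)
  qed
  have all0: "(LINT x|lborel. g x) = 0"
  proof -
    have "(LINT x|lborel. g x) = (LINT x|lebesgue. g x)" using g(1) by (rule integral_completion[symmetric])
    also have "\<dots> = (LINT x|lebesgue. f x)" using gl f fg by (intro integral_cong_AE) auto
    also have "\<dots> = (LINT x:box a b|lebesgue. f x)"
      unfolding set_lebesgue_integral_def f_def
      by (intro Bochner_Integration.integral_cong) (auto simp: indicator_def)
    also have "\<dots> = 0" using box0[of a b] gA[of "box a b"] by simp
    finally show ?thesis .
  qed
  have "(LINT x:A|lborel. g x) = 0" if "A \<in> sets borel" for A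
  proof -
    define E where "E = range (\<lambda>(a, b). box a b :: 'a set)"
    have "Int_stable E" unfolding E_def Int_stable_def by (auto simp: box_Int_box)
    moreover have "E \<subseteq> Pow UNIV" by simp
    moreover have "A \<in> sigma_sets UNIV E"
      using that unfolding E_def by (subst (asm) borel_eq_box) simp
    ultimately show ?thesis
    proof (induction rule: sigma_sets_induct_disjoint)
      case (basic A)
      then show ?case using box0 by (auto simp: E_def)
    next
      case empty
      show ?case by (simp add: set_lebesgue_integral_def)
    next
      case (compl A)
      have A: "A \<in> sets borel" using compl(1) unfolding E_def by (subst borel_eq_box) simp
      have "set_integrable lborel A g" "set_integrable lborel (- A) g"
        unfolding set_integrable_def using A by (intro integrable_mult_indicator gint; simp)+
      then have "(LINT x:A \<union> - A|lborel. g x) = (LINT x:A|lborel. g x) + (LINT x:- A|lborel. g x)"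
        by (intro set_integral_Un) auto
      then show ?case using compl(2) all0 by (simp add: Compl_eq_Diff_UNIV set_lebesgue_integral_def)
    next
      case (union A)
      have A: "A i \<in> sets borel" for i
      proof -
        have "A i \<in> sigma_sets UNIV E" using union(2) by auto
        then show ?thesis unfolding E_def by (subst borel_eq_box) simp
      qed
      have "(LINT x:(\<Union>i. A i)|lborel. g x) = (\<Sum>i. LINT x:A i|lborel. g x)"
      proof (rule lebesgue_integral_countable_add)
        show "set_integrable lborel (\<Union>i. A i) g"
          using A gint unfolding set_integrable_def by (intro integrable_mult_indicator) auto
        show "A i \<inter> A j = {}" if "i \<noteq> j" for i j
          using union(1) that by (auto simp: disjoint_family_on_def)
      qed (use A in auto)
      then show ?case using union(3) by simp
    qed
  qed
  then have "AE x in lborel. g x = 0"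
    by (intro sigma_finite_measure.density_zero[OF lborel.sigma_finite_measure_axioms gint]) simp
  with g(2) show ?thesis
    by eventually_elim (auto simp: f_def)
qed

text \<open>Countably many closed boxes exhaust \<open>U\<close>. The result for a box speaks about
  its interior, and the faces are negligible.\<close>

lemma AE_eq_0_open:
  fixes H :: "'a::euclidean_space \<Rightarrow> real"
  assumes H: "loc_integrable U H"
    and 0: "\<And>\<phi>. \<phi> \<in> Cinfc U \<Longrightarrow> (LINT x:U|lebesgue. H x * \<phi> x) = 0"
    and U: "open U"
  shows "AE x in lebesgue. x \<in> U \<longrightarrow> H x = 0"
proof -
  obtain \<D> where \<D>: "countable \<D>" "\<D> \<subseteq> Pow U" "\<And>X. X \<in> \<D> \<Longrightarrow> \<exists>a b. X = cbox a b" "\<Union>\<D> = U"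
    using open_countable_Union_open_cbox[OF U] by metis
  have "AE x in lborel. x \<in> X \<longrightarrow> H x = 0" if X: "X \<in> \<D>" for X
  proof -
    obtain a b where X_eq: "X = cbox a b" using \<D>(3)[OF X] by blast
    have "cbox a b \<subseteq> U" using \<D>(2) X X_eq by auto
    with H 0 have *: "AE x in lborel. x \<in> box a b \<longrightarrow> H x = 0" by (rule AE_eq_0_box)
    have "negligible (cbox a b - box a b)" by (rule negligible_frontier_interval)
    then have "AE x in lborel. x \<notin> cbox a b - box a b"
      by (metis AE_not_in AE_completion_iff negligible_iff_null_sets)
    with * show ?thesis unfolding X_eq by eventually_elim auto
  qed
  then have "AE x in lborel. \<forall>X\<in>\<D>. x \<in> X \<longrightarrow> H x = 0"
    by (subst AE_ball_countable[OF \<D>(1)]) blast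
  then have "AE x in lborel. x \<in> U \<longrightarrow> H x = 0"
    by eventually_elim (use \<D>(4) in blast)
  then show ?thesis by (rule AE_completion)
qed

text \<open>Against a test function, each component of \<open>G\<close> and of \<open>G'\<close>
  integrates to the same value, determined by \<open>u\<close>. To subtract the two integrals, both
  products must be integrable, which holds because the test function is bounded and lives on a
  compact subset of \<open>U\<close>.\<close>

lemma weak_gradient_unique:
  fixes U :: "'a::euclidean_space set"
  assumes U: "open U" and G: "weak_gradient U u G" and G': "weak_gradient U u G'"
  shows "AE x in lebesgue. x \<in> U \<longrightarrow> G x = G' x"
proof -
  have "AE x in lebesgue. x \<in> U \<longrightarrow> (G x - G' x) \<bullet> b = 0" if b: "b \<in> Basis" for b
  proof (rule AE_eq_0_open[OF _ _ U])
    have lG: "loc_integrable U G" "loc_integrable U G'" using G G' by (auto simp: weak_gradient_def)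
    have lb: "set_integrable lebesgue C (\<lambda>x. G x \<bullet> b)" "set_integrable lebesgue C (\<lambda>x. G' x \<bullet> b)"
      if "compact C" "C \<subseteq> U" for C
    proof -
      have "integrable lebesgue (\<lambda>x. (indicator C x *\<^sub>R G x) \<bullet> b)" "integrable lebesgue (\<lambda>x. (indicator C x *\<^sub>R G' x) \<bullet> b)"
        using lG that unfolding loc_integrable_def set_integrable_def
        by (auto intro!: integrable_inner_left simp del: inner_scaleR_left)
      then show "set_integrable lebesgue C (\<lambda>x. G x \<bullet> b)" "set_integrable lebesgue C (\<lambda>x. G' x \<bullet> b)"
        by (simp_all add: set_integrable_def)
    qed
    then show "loc_integrable U (\<lambda>x. (G x - G' x) \<bullet> b)"
      unfolding loc_integrable_def by (auto simp: inner_diff_left intro!: set_integral_diff)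
    fix \<phi> assume \<phi>: "\<phi> \<in> Cinfc U"
    define C where "C = closure {x. \<phi> x \<noteq> 0}"
    have C: "compact C" "C \<subseteq> U" using \<phi> by (auto simp: Cinfc_def compactly_supported_in_def C_def)
    have \<phi>0: "\<phi> x = 0" if "x \<notin> C" for x
      using that closure_subset[of "{x. \<phi> x \<noteq> 0}"] by (auto simp: C_def)
    have c\<phi>: "continuous_on UNIV \<phi>"
      using \<phi> by (auto simp: Cinfc_def smooth_on_def dest: spec[of _ 0])
    then obtain B where B: "B \<ge> 0" "\<And>x. x \<in> C \<Longrightarrow> norm (\<phi> x) \<le> B"
      using bounded_on_compact[OF C(1), of \<phi>] continuous_on_subset by blast
    have m\<phi>: "\<phi> \<in> borel_measurable lebesgue"
      by (intro measurable_completion) (simp add: c\<phi> borel_measurable_continuous_onI)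
    have int: "set_integrable lebesgue U (\<lambda>x. f x * \<phi> x)" if "set_integrable lebesgue C f" for f :: "'a \<Rightarrow> real"
    proof -
      have f: "integrable lebesgue (\<lambda>x. indicator C x *\<^sub>R f x)" using that by (simp add: set_integrable_def)
      have "integrable lebesgue (\<lambda>x. (indicator C x *\<^sub>R f x) * \<phi> x)"
      proof (rule Bochner_Integration.integrable_bound)
        show "integrable lebesgue (\<lambda>x. B * \<bar>indicator C x *\<^sub>R f x\<bar>)" using f by (intro integrable_mult_right integrable_abs)
        show "(\<lambda>x. (indicator C x *\<^sub>R f x) * \<phi> x) \<in> borel_measurable lebesgue"
          using f m\<phi> by (intro borel_measurable_times) auto
        show "AE x in lebesgue. norm ((indicator C x *\<^sub>R f x) * \<phi> x) \<le> norm (B * \<bar>indicator C x *\<^sub>R f x\<bar>)"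
        proof (rule AE_I2)
          fix x
          show "norm ((indicator C x *\<^sub>R f x) * \<phi> x) \<le> norm (B * \<bar>indicator C x *\<^sub>R f x\<bar>)"
            using B(1) mult_right_mono[OF B(2)[of x], of "\<bar>f x\<bar>"]
            by (auto simp: indicator_def abs_mult mult.commute)
        qed
      qed
      also have "(\<lambda>x. (indicator C x *\<^sub>R f x) * \<phi> x) = (\<lambda>x. indicator U x *\<^sub>R (f x * \<phi> x))"
        using \<phi>0 C(2) by (fastforce simp: indicator_def)
      finally show ?thesis by (simp add: set_integrable_def)
    qed
    have "(LINT x:U|lebesgue. (G x - G' x) \<bullet> b * \<phi> x)
        = (LINT x:U|lebesgue. (G x \<bullet> b) * \<phi> x) - (LINT x:U|lebesgue. (G' x \<bullet> b) * \<phi> x)"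
      using int[OF lb(1)[OF C]] int[OF lb(2)[OF C]]
      by (simp add: inner_diff_left left_diff_distrib set_integral_diff)
    also have "\<dots> = 0" using G G' \<phi> b unfolding weak_gradient_def by force
    finally show "(LINT x:U|lebesgue. (G x - G' x) \<bullet> b * \<phi> x) = 0" .
  qed
  then have "AE x in lebesgue. \<forall>b\<in>Basis. x \<in> U \<longrightarrow> (G x - G' x) \<bullet> b = 0"
    by (intro AE_finite_allI) auto
  then show ?thesis
    by eventually_elim (auto simp: inner_diff_left euclidean_eq_iff[where 'a = 'a])
qed

subsection \<open>Passage to the limit\<close>

text \<open>Either \<open>b - a\<close> is small relative to \<open>b\<close>, and the first term
  alone suffices, or \<open>b\<close> is controlled by \<open>b - a\<close>, and the second does.
  The point is the factor \<open>(1 + \<eta>) powr p\<close> near 1, which lets a sharp constant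
  survive the limit.\<close>

lemma powr_norm_le:
  fixes a b :: "'a::real_normed_vector"
  assumes "\<eta> > 0" "p \<ge> 0"
  shows "norm a powr p \<le> (1 + \<eta>) powr p * norm b powr p + (1 + 1 / \<eta>) powr p * norm (b - a) powr p"
proof (cases "norm (b - a) \<le> \<eta> * norm b")
  case True
  have "norm a \<le> (1 + \<eta>) * norm b"
    using True norm_triangle_ineq3[of a b] by (simp add: norm_minus_commute algebra_simps)
  then have "norm a powr p \<le> ((1 + \<eta>) * norm b) powr p" using assms by (intro powr_mono2) auto
  also have "\<dots> = (1 + \<eta>) powr p * norm b powr p" using assms by (simp add: powr_mult)
  finally show ?thesis by (simp add: add_increasing2)
next
  case False
  then have "norm b \<le> 1 / \<eta> * norm (b - a)" using assms by (simp add: field_simps)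
  then have "norm a \<le> (1 + 1 / \<eta>) * norm (b - a)"
    using norm_triangle_ineq3[of a b] by (simp add: norm_minus_commute algebra_simps)
  then have "norm a powr p \<le> ((1 + 1 / \<eta>) * norm (b - a)) powr p" using assms by (intro powr_mono2) auto
  also have "\<dots> = (1 + 1 / \<eta>) powr p * norm (b - a) powr p" using assms by (simp add: powr_mult)
  finally show ?thesis by (simp add: add_increasing)
qed

lemma nn_integral_powr_norm_le:
  fixes f g :: "'a \<Rightarrow> 'b::euclidean_space" and w :: "'a \<Rightarrow> real"
  assumes [measurable]: "f \<in> borel_measurable M" "g \<in> borel_measurable M" "w \<in> borel_measurable M"
    and w: "\<And>x. 0 \<le> w x" "\<And>x. w x \<le> C" and \<eta>: "\<eta> > 0" "p \<ge> 0"
  shows "(\<integral>\<^sup>+x. ennreal (norm (f x) powr p * w x) \<partial>M)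
    \<le> ennreal ((1 + \<eta>) powr p) * (\<integral>\<^sup>+x. ennreal (norm (g x) powr p * w x) \<partial>M)
      + ennreal ((1 + 1 / \<eta>) powr p * C) * (\<integral>\<^sup>+x. ennreal (norm (g x - f x) powr p) \<partial>M)"
proof -
  have C: "C \<ge> 0" using w order_trans by blast
  have "(\<integral>\<^sup>+x. ennreal (norm (f x) powr p * w x) \<partial>M)
    \<le> (\<integral>\<^sup>+x. ennreal ((1 + \<eta>) powr p) * ennreal (norm (g x) powr p * w x)
        + ennreal ((1 + 1 / \<eta>) powr p * C) * ennreal (norm (g x - f x) powr p) \<partial>M)"
  proof (rule nn_integral_mono)
    fix x
    have "norm (f x) powr p * w x
      \<le> ((1 + \<eta>) powr p * norm (g x) powr p + (1 + 1 / \<eta>) powr p * norm (g x - f x) powr p) * w x"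
      by (intro mult_right_mono powr_norm_le \<eta> w)
    also have "\<dots> = (1 + \<eta>) powr p * (norm (g x) powr p * w x) + (1 + 1 / \<eta>) powr p * norm (g x - f x) powr p * w x"
      by (simp add: algebra_simps)
    also have "\<dots> \<le> (1 + \<eta>) powr p * (norm (g x) powr p * w x) + (1 + 1 / \<eta>) powr p * norm (g x - f x) powr p * C"
      by (intro add_left_mono mult_left_mono w) auto
    finally show "ennreal (norm (f x) powr p * w x)
      \<le> ennreal ((1 + \<eta>) powr p) * ennreal (norm (g x) powr p * w x)
        + ennreal ((1 + 1 / \<eta>) powr p * C) * ennreal (norm (g x - f x) powr p)"
      using w(1)[of x] C by (simp add: ac_simps flip: ennreal_mult ennreal_plus)
  qed
  also have "\<dots> = ennreal ((1 + \<eta>) powr p) * (\<integral>\<^sup>+x. ennreal (norm (g x) powr p * w x) \<partial>M)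
      + ennreal ((1 + 1 / \<eta>) powr p * C) * (\<integral>\<^sup>+x. ennreal (norm (g x - f x) powr p) \<partial>M)"
    by (simp add: nn_integral_add nn_integral_cmult)
  finally show ?thesis .
qed

text \<open>Convergence in the p-th power says nothing about integrals with the unbounded weight
  \<open>w\<close>. So the weight is truncated at \<open>m\<close>: for fixed \<open>m\<close> and
  \<eta> the error terms vanish as \<open>n\<close> grows, then \<eta> tends to 0, and monotone
  convergence removes the truncation.\<close>

lemma weighted_inequality_Lp_limit:
  fixes f :: "'a \<Rightarrow> 'b::euclidean_space" and F :: "'a \<Rightarrow> 'c::euclidean_space" and w :: "'a \<Rightarrow> real"
  assumes [measurable]: "f \<in> borel_measurable M" "F \<in> borel_measurable M" "w \<in> borel_measurable M"
      "\<And>n. fs n \<in> borel_measurable M" "\<And>n. Fs n \<in> borel_measurable M"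
    and w: "\<And>x. 0 \<le> w x" and p: "p \<ge> 0" and c: "c \<ge> 0"
    and ineq: "\<And>n. ennreal c * (\<integral>\<^sup>+x. ennreal (norm (fs n x) powr p * w x) \<partial>M)
      \<le> (\<integral>\<^sup>+x. ennreal (norm (Fs n x) powr p) \<partial>M)"
    and f: "(\<lambda>n. \<integral>\<^sup>+x. ennreal (norm (fs n x - f x) powr p) \<partial>M) \<longlonglongrightarrow> 0"
    and F: "(\<lambda>n. \<integral>\<^sup>+x. ennreal (norm (Fs n x - F x) powr p) \<partial>M) \<longlonglongrightarrow> 0"
  shows "ennreal c * (\<integral>\<^sup>+x. ennreal (norm (f x) powr p * w x) \<partial>M)
    \<le> (\<integral>\<^sup>+x. ennreal (norm (F x) powr p) \<partial>M)"
proof -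
  define R where "R = (\<integral>\<^sup>+x. ennreal (norm (F x) powr p) \<partial>M)"
  define I where "I m = (\<integral>\<^sup>+x. ennreal (norm (f x) powr p * min (w x) (real m)) \<partial>M)" for m
  \<comment> \<open>The factor occurs twice, once for passing from \<open>f\<close> to
    \<open>fs n\<close> and once for passing from \<open>Fs n\<close> back to
    \<open>F\<close>.\<close>
  have 1: "ennreal c * I m \<le> ennreal ((1 + \<eta>) powr p * (1 + \<eta>) powr p) * R" if \<eta>: "\<eta> > 0" for m \<eta>
  proof -
    define e where "e n = (\<integral>\<^sup>+x. ennreal (norm (fs n x - f x) powr p) \<partial>M)" for n
    define e' where "e' n = (\<integral>\<^sup>+x. ennreal (norm (Fs n x - F x) powr p) \<partial>M)" for n
    define q where "q = (1 + \<eta>) powr p"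
    define C where "C = (1 + 1 / \<eta>) powr p"
    have q: "q \<ge> 0" "C \<ge> 0" by (auto simp: q_def C_def)
    have bound: "ennreal c * I m \<le> ennreal (q * q) * R + (ennreal (q * C) * e' n + ennreal (c * (C * real m)) * e n)" for n
    proof -
      have "I m \<le> ennreal q * (\<integral>\<^sup>+x. ennreal (norm (fs n x) powr p * min (w x) (real m)) \<partial>M) + ennreal (C * real m) * e n"
        unfolding I_def e_def q_def C_def by (rule nn_integral_powr_norm_le) (use w \<eta> p in auto)
      also have "(\<integral>\<^sup>+x. ennreal (norm (fs n x) powr p * min (w x) (real m)) \<partial>M)
          \<le> (\<integral>\<^sup>+x. ennreal (norm (fs n x) powr p * w x) \<partial>M)"
        by (intro nn_integral_mono ennreal_leI mult_left_mono) auto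
      finally have "ennreal c * I m \<le> ennreal c * (ennreal q * (\<integral>\<^sup>+x. ennreal (norm (fs n x) powr p * w x) \<partial>M)
          + ennreal (C * real m) * e n)"
        by (simp add: mult_left_mono add_right_mono)
      also have "\<dots> = ennreal q * (ennreal c * (\<integral>\<^sup>+x. ennreal (norm (fs n x) powr p * w x) \<partial>M))
          + ennreal (c * (C * real m)) * e n"
        using c q by (simp add: distrib_left ennreal_mult ac_simps)
      also have "\<dots> \<le> ennreal q * (\<integral>\<^sup>+x. ennreal (norm (Fs n x) powr p) \<partial>M) + ennreal (c * (C * real m)) * e n"
        by (intro add_right_mono mult_left_mono ineq) auto
      also have "(\<integral>\<^sup>+x. ennreal (norm (Fs n x) powr p) \<partial>M) \<le> ennreal q * R + ennreal C * e' n"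
        using nn_integral_powr_norm_le[of "Fs n" M F "\<lambda>x. 1" 1 \<eta> p] \<eta> p
        by (simp add: R_def e'_def q_def C_def norm_minus_commute)
      also have "ennreal q * (ennreal q * R + ennreal C * e' n) + ennreal (c * (C * real m)) * e n
        = ennreal (q * q) * R + (ennreal (q * C) * e' n + ennreal (c * (C * real m)) * e n)"
        using q by (simp add: distrib_left ennreal_mult ac_simps)
      finally show ?thesis by (simp add: mult_left_mono add_right_mono)
    qed
    have "(\<lambda>n. ennreal (q * q) * R + (ennreal (q * C) * e' n + ennreal (c * (C * real m)) * e n))
        \<longlonglongrightarrow> ennreal (q * q) * R + (ennreal (q * C) * 0 + ennreal (c * (C * real m)) * 0)"
      using f F unfolding e_def[symmetric] e'_def[symmetric]
      by (intro tendsto_add tendsto_const ennreal_tendsto_cmult) auto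
    then have "ennreal c * I m \<le> ennreal (q * q) * R + (ennreal (q * C) * 0 + ennreal (c * (C * real m)) * 0)"
      by (rule LIMSEQ_le_const) (use bound in auto)
    then show ?thesis by (simp add: q_def)
  qed
  have 2: "ennreal c * I m \<le> R" for m
  proof (cases "R = top")
    case False
    then obtain r where r: "R = ennreal r" "r \<ge> 0" by (cases R) auto
    have "(\<lambda>n. ennreal ((1 + inverse (real (Suc n))) powr p * (1 + inverse (real (Suc n))) powr p * r))
        \<longlonglongrightarrow> ennreal ((1 + 0) powr p * (1 + 0) powr p * r)"
      by (intro tendsto_ennrealI tendsto_intros LIMSEQ_inverse_real_of_nat) auto
    then have "ennreal c * I m \<le> ennreal ((1 + 0) powr p * (1 + 0) powr p * r)"
    proof (rule LIMSEQ_le_const, intro exI[of _ 0] allI impI)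
      fix n :: nat
      show "ennreal c * I m \<le> ennreal ((1 + inverse (real (Suc n))) powr p * (1 + inverse (real (Suc n))) powr p * r)"
        using 1[of "inverse (real (Suc n))" m] r by (simp add: ennreal_mult)
    qed
    then show ?thesis by (simp add: r)
  qed simp
  have "incseq (\<lambda>m x. ennreal (norm (f x) powr p * min (w x) (real m)))"
    by (intro monoI le_funI ennreal_leI mult_left_mono) auto
  moreover have "(SUP m. ennreal (norm (f x) powr p * min (w x) (real m))) = ennreal (norm (f x) powr p * w x)" for x
  proof (rule antisym)
    show "(SUP m. ennreal (norm (f x) powr p * min (w x) (real m))) \<le> ennreal (norm (f x) powr p * w x)"
      by (intro SUP_least ennreal_leI mult_left_mono) auto
    obtain m where "w x \<le> real m" using real_arch_simple by blast
    then have "ennreal (norm (f x) powr p * w x) = ennreal (norm (f x) powr p * min (w x) (real m))" by simp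
    then show "ennreal (norm (f x) powr p * w x) \<le> (SUP m. ennreal (norm (f x) powr p * min (w x) (real m)))"
      by (metis SUP_upper UNIV_I)
  qed
  ultimately have "(\<integral>\<^sup>+x. ennreal (norm (f x) powr p * w x) \<partial>M) = (SUP m. I m)"
    using nn_integral_monotone_convergence_SUP[of "\<lambda>m x. ennreal (norm (f x) powr p * min (w x) (real m))" M]
    by (simp add: I_def)
  then show ?thesis
    using 2 by (simp add: SUP_mult_left_ennreal SUP_least R_def)
qed

subsection \<open>The endpoint value of D\<close>

lemma Cinfc_subset_C1c: "Cinfc U \<subseteq> C1c U"
  by (auto simp: Cinfc_def C1c_def smooth_on_def simp del: Ck_on.simps)

text \<open>By the conventions for division by 0 and \<open>ln\<close>, the weight is 0 on
  \<open>K\<close> and where the distance equals \<open>D\<close>, so it is a total nonnegative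
  function.\<close>

definition Hardy_weight :: "'a::euclidean_space set \<Rightarrow> real \<Rightarrow> real \<Rightarrow> 'a \<Rightarrow> real" where
  "Hardy_weight K D p x = X (infdist x K / D) powr p / infdist x K powr p"

lemma borel_measurable_Hardy_weight [measurable]:
  "Hardy_weight K D p \<in> borel_measurable borel"
proof -
  have [measurable]: "(\<lambda>x. infdist x K) \<in> borel_measurable borel"
    by (intro borel_measurable_continuous_onI continuous_intros)
  show ?thesis unfolding Hardy_weight_def X_def by measurable
qed

text \<open>The strict version applies with each \<open>D + inverse (Suc n)\<close> in place of
  \<open>D\<close>, and its constant does not depend on \<open>n\<close>. As these values decrease
  to \<open>D\<close>, Fatou's lemma carries the bound over without any domination.\<close>

lemma Hardy_C1c:
  fixes \<Omega> K :: "'a::euclidean_space set"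
  assumes K: "closed K" "K \<noteq> {}" and \<Omega>: "open \<Omega>"
    and A: "\<And>\<phi>. \<phi> \<in> C1c (\<Omega> - K) \<Longrightarrow> (\<And>x. \<phi> x \<ge> 0) \<Longrightarrow> A_fun \<Omega> K (m + 2) \<phi> \<ge> 0"
    and D: "\<And>x. x \<in> \<Omega> \<Longrightarrow> infdist x K \<le> D"
    and \<phi>: "\<phi> \<in> C1c (\<Omega> - K)" and p: "p = real (m + 2)"
  shows "ennreal (((p - 1) / p) powr p) * (\<integral>\<^sup>+x. ennreal (norm (\<phi> x) powr p * Hardy_weight K D p x) \<partial>lebesgue)
    \<le> (\<integral>\<^sup>+x. ennreal (norm (grad \<phi> x) powr p) \<partial>lebesgue)"
proof -
  let ?d = "\<lambda>x. infdist x K"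
  define l where "l = (real m + 1) / (real m + 2)"
  have l: "l > 0" "((p - 1) / p) powr p = l ^ (m + 2)"
  proof -
    show "l > 0" by (simp add: l_def)
    moreover have "(p - 1) / p = l" by (simp add: l_def p add.commute)
    ultimately show "((p - 1) / p) powr p = l ^ (m + 2)" unfolding p by (simp only: powr_realpow)
  qed
  define Dn where "Dn n = D + inverse (real (Suc n))" for n
  define c where "c n x = \<bar>\<phi> x\<bar> / (?d x * ln (Dn n / ?d x))" for n x
  define J where "J = (\<integral>\<^sup>+x. ennreal (norm (grad \<phi> x) powr p) \<partial>lebesgue)"
  \<comment> \<open>The base 0 is separate because \<open>powr_realpow\<close> needs a positive
    base; both sides are then 0, the exponent being at least 2.\<close>
  have pw: "t powr p = t ^ (m + 2)" if "t \<ge> 0" for t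
    unfolding p using that powr_realpow[of t "m + 2"] by (cases "t = 0") auto
  have Dn: "?d x < Dn n" if "x \<in> \<Omega>" for n x
    using D[OF that] by (simp add: Dn_def add.commute less_add_same_cancel1 order_le_less_trans)
  have \<phi>0: "\<phi> x = 0" if "x \<notin> \<Omega> - K" for x
  proof -
    have "closure {x. \<phi> x \<noteq> 0} \<subseteq> \<Omega> - K" using \<phi> by (auto simp: C1c_def compactly_supported_in_def)
    then show ?thesis using that closure_subset[of "{x. \<phi> x \<noteq> 0}"] by blast
  qed
  have dpos: "?d x > 0" if "\<phi> x \<noteq> 0" for x
    using \<phi>0[of x] that infdist_pos_not_in_closed[OF K, of x] by blast
  have c_nonneg: "c n x \<ge> 0" for n x
  proof (cases "\<phi> x = 0")
    case False
    then have "x \<in> \<Omega>" using \<phi>0 by blast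
    then have "ln (Dn n / ?d x) > 0" using Dn[of x n] dpos[OF False] by simp
    then show ?thesis using infdist_nonneg[of x K] unfolding c_def by (intro divide_nonneg_nonneg mult_nonneg_nonneg) auto
  qed (simp add: c_def)
  have bound: "ennreal (l ^ (m + 2)) * (\<integral>\<^sup>+x. ennreal (c n x ^ (m + 2)) \<partial>lborel) \<le> J" for n
  proof -
    note H = Hardy_C1c_strict[OF K \<Omega> A Dn[of _ n] \<phi>, folded l_def, folded c_def]
    have 1: "(\<integral>\<^sup>+x. ennreal (c n x ^ (m + 2)) \<partial>lborel) = ennreal (LINT x|lborel. c n x ^ (m + 2))"
      using H(1) c_nonneg by (intro nn_integral_eq_integral) auto
    have "J = (\<integral>\<^sup>+x. ennreal (norm (grad \<phi> x) ^ (m + 2)) \<partial>lborel)"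
      unfolding J_def by (simp add: nn_integral_completion pw del: power_Suc)
    also have "\<dots> = ennreal (LINT x|lborel. norm (grad \<phi> x) ^ (m + 2))"
      using H(2) by (intro nn_integral_eq_integral) auto
    finally have 2: "J = ennreal (LINT x|lborel. norm (grad \<phi> x) ^ (m + 2))" .
    have "ennreal (l ^ (m + 2)) * ennreal (LINT x|lborel. c n x ^ (m + 2))
        = ennreal (l ^ (m + 2) * (LINT x|lborel. c n x ^ (m + 2)))"
      using l(1) by (simp add: ennreal_mult')
    also have "\<dots> \<le> J" unfolding 2 using H(3) by (rule ennreal_leI)
    finally show ?thesis unfolding 1 .
  qed
  have mc: "(\<lambda>x. ennreal (c n x ^ (m + 2))) \<in> borel_measurable lborel" for n
  proof -
    note H = Hardy_C1c_strict[OF K \<Omega> A Dn[of _ n] \<phi>, folded l_def, folded c_def]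
    show ?thesis using borel_measurable_integrable[OF H(1)] by measurable
  qed
  \<comment> \<open>Where the distance equals \<open>D\<close>, the formula for \<open>X\<close>
    gives 0 and the bound is trivial. At the other points of the support \<open>c n x\<close> has a
    finite limit.\<close>
  have lim: "ennreal (norm (\<phi> x) powr p * Hardy_weight K D p x) \<le> liminf (\<lambda>n. ennreal (c n x ^ (m + 2)))" for x
  proof (cases "\<phi> x = 0 \<or> ?d x = D")
    case True
    then have e: "norm (\<phi> x) powr p * Hardy_weight K D p x = 0"
    proof
      assume "?d x = D"
      then have "X (?d x / D) = 0" by (cases "D = 0") (auto simp: X_def)
      then show ?thesis by (simp add: Hardy_weight_def)
    qed simp
    show ?thesis unfolding e by simp
  next
    case False
    then have x: "x \<in> \<Omega>" using \<phi>0 by blast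
    have d: "0 < ?d x" "?d x < D" using dpos D[OF x] False by auto
    then have L: "ln (D / ?d x) > 0" by simp
    have X: "X (?d x / D) = 1 / ln (D / ?d x)"
      using d by (simp add: X_def ln_div)
        (metis minus_diff_eq minus_divide_right)
    have "norm (\<phi> x) powr p * Hardy_weight K D p x = (\<bar>\<phi> x\<bar> / (?d x * ln (D / ?d x))) ^ (m + 2)"
      unfolding Hardy_weight_def X using d L
      by (simp only: pw norm_ge_zero less_imp_le zero_le_divide_1_iff real_norm_def power_divide power_mult_distrib power_one)
        simp
    moreover have "(\<lambda>n. c n x ^ (m + 2)) \<longlonglongrightarrow> (\<bar>\<phi> x\<bar> / (?d x * ln (D / ?d x))) ^ (m + 2)"
    proof -
      have "Dn \<longlonglongrightarrow> D + 0" unfolding Dn_def by (intro tendsto_intros LIMSEQ_inverse_real_of_nat)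
      then have "Dn \<longlonglongrightarrow> D" by simp
      then show ?thesis unfolding c_def using d L by (intro tendsto_intros) auto
    qed
    ultimately have "(\<lambda>n. ennreal (c n x ^ (m + 2))) \<longlonglongrightarrow> ennreal (norm (\<phi> x) powr p * Hardy_weight K D p x)"
      by (simp only:) (rule tendsto_ennrealI)
    then show ?thesis by (simp only: lim_imp_Liminf[OF sequentially_bot] order_refl)
  qed
  have inv: "ennreal (1 / l ^ (m + 2)) * ennreal (l ^ (m + 2)) = 1"
    using l(1) by (simp del: power_Suc flip: ennreal_mult)
  have "(\<integral>\<^sup>+x. ennreal (norm (\<phi> x) powr p * Hardy_weight K D p x) \<partial>lebesgue)
      = (\<integral>\<^sup>+x. ennreal (norm (\<phi> x) powr p * Hardy_weight K D p x) \<partial>lborel)"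
    by (rule nn_integral_completion)
  also have "\<dots> \<le> (\<integral>\<^sup>+x. liminf (\<lambda>n. ennreal (c n x ^ (m + 2))) \<partial>lborel)"
    by (intro nn_integral_mono lim)
  also have "\<dots> \<le> liminf (\<lambda>n. \<integral>\<^sup>+x. ennreal (c n x ^ (m + 2)) \<partial>lborel)"
    by (intro nn_integral_liminf mc)
  also have "\<dots> \<le> ennreal (1 / l ^ (m + 2)) * J"
  proof (rule Liminf_le)
    have "(\<integral>\<^sup>+x. ennreal (c n x ^ (m + 2)) \<partial>lborel) \<le> ennreal (1 / l ^ (m + 2)) * J" for n
    proof -
      have "(\<integral>\<^sup>+x. ennreal (c n x ^ (m + 2)) \<partial>lborel)
          = ennreal (1 / l ^ (m + 2)) * (ennreal (l ^ (m + 2)) * (\<integral>\<^sup>+x. ennreal (c n x ^ (m + 2)) \<partial>lborel))"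
        unfolding inv mult.assoc[symmetric] by simp
      also have "\<dots> \<le> ennreal (1 / l ^ (m + 2)) * J" by (intro mult_left_mono bound) simp
      finally show ?thesis .
    qed
    then show "\<forall>\<^sub>F n in sequentially. (\<integral>\<^sup>+x. ennreal (c n x ^ (m + 2)) \<partial>lborel) \<le> ennreal (1 / l ^ (m + 2)) * J"
      by simp
  qed simp
  finally have "ennreal (l ^ (m + 2)) * (\<integral>\<^sup>+x. ennreal (norm (\<phi> x) powr p * Hardy_weight K D p x) \<partial>lebesgue)
      \<le> ennreal (l ^ (m + 2)) * (ennreal (1 / l ^ (m + 2)) * J)"
    by (rule mult_left_mono) simp
  also have "\<dots> = J" using inv by (simp only: mult.assoc[symmetric] mult.commute[of "ennreal (l ^ (m + 2))"] mult_1)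
  finally show ?thesis unfolding l(2) J_def .
qed

theorem theorem4p2:
  fixes \<Omega> K :: "'a::euclidean_space set" and k :: nat and p D :: real
    and u :: "'a \<Rightarrow> real" and G :: "'a \<Rightarrow> 'a"
  assumes "open \<Omega>" and "connected \<Omega>" and "\<Omega> \<noteq> {}"
    and "surface_of_codim k K"
    and "p = real k" and "p > 1"
    and "bdd_above ((\<lambda>x. infdist x K) ` \<Omega>)"
    and "\<And>\<phi>. \<phi> \<in> C1c (\<Omega> - K) \<Longrightarrow> (\<And>x. \<phi> x \<ge> 0) \<Longrightarrow> A_fun \<Omega> K k \<phi> \<ge> 0"
    and "D \<ge> (SUP x\<in>\<Omega>. infdist x K)"
    and "u \<in> W1p0 p (\<Omega> - K)" and "weak_gradient (\<Omega> - K) u G"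
  shows "(\<integral>\<^sup>+x\<in>\<Omega>. ennreal (norm (G x) powr p) \<partial>lebesgue)
    \<ge> ennreal (((p - 1) / p) powr p) *
      (\<integral>\<^sup>+x\<in>\<Omega>. ennreal (\<bar>u x\<bar> powr p / infdist x K powr p * X (infdist x K / D) powr p) \<partial>lebesgue)"
proof -
  define U where "U = \<Omega> - K"
  have K: "closed K" "K \<noteq> {}"
    using assms(4) by (auto simp: surface_of_codim_def split: if_splits)
  have U: "open U" using assms(1) K(1) by (auto simp: U_def)
  define m where "m = k - 2"
  have k: "k = m + 2" using assms(5,6) by (auto simp: m_def)
  have p: "p = real (m + 2)" "p \<ge> 0" using assms(5) k by auto
  have D: "infdist x K \<le> D" if "x \<in> \<Omega>" for x
    using cSUP_upper[OF that assms(7)] assms(9) by linarith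
  obtain G' \<phi> where u: "in_Lp p U u" and G': "weak_gradient U u G'" "in_Lp p U G'"
    and \<phi>: "\<And>n. \<phi> n \<in> Cinfc U"
    and lim0: "(\<lambda>n. \<integral>\<^sup>+x\<in>U. ennreal (norm (\<phi> n x - u x) powr p) \<partial>lebesgue) \<longlonglongrightarrow> 0"
    and lim1: "(\<lambda>n. \<integral>\<^sup>+x\<in>U. ennreal (norm (grad (\<phi> n) x - G' x) powr p) \<partial>lebesgue) \<longlonglongrightarrow> 0"
    using assms(10) unfolding W1p0_def W1p_def U_def[symmetric] by blast
  have \<phi>C: "\<phi> n \<in> C1c U" for n using \<phi> Cinfc_subset_C1c by blast
  have C1: "Ck_on 1 (\<phi> n) UNIV" for n using \<phi>C by (simp add: C1c_def)
  have supp: "closure {x. \<phi> n x \<noteq> 0} \<subseteq> U" for n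
    using \<phi>C[of n] by (auto simp: C1c_def compactly_supported_in_def)
  have \<phi>0: "\<phi> n x = 0" if "x \<notin> U" for n x
    using supp[of n] that closure_subset[of "{x. \<phi> n x \<noteq> 0}"] by blast
  have g\<phi>0: "grad (\<phi> n) x = 0" if "x \<notin> U" for n x
  proof (rule grad_eqI)
    have "((\<lambda>y. 0) has_derivative (\<lambda>h. h \<bullet> 0)) (at x)" by simp
    moreover have "open (- closure {x. \<phi> n x \<noteq> 0})" by (intro open_Compl closed_closure)
    moreover have "x \<in> - closure {x. \<phi> n x \<noteq> 0}" using supp[of n] that by blast
    moreover have "0 = \<phi> n y" if "y \<in> - closure {x. \<phi> n x \<noteq> 0}" for y
    proof (rule ccontr)
      assume "0 \<noteq> \<phi> n y"
      then have "y \<in> closure {x. \<phi> n x \<noteq> 0}" by (intro subsetD[OF closure_subset]) auto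
      with that show False by blast
    qed
    ultimately show "GDERIV (\<phi> n) x :> 0"
      unfolding gderiv_def by (rule has_derivative_transform_within_open)
  qed
  \<comment> \<open>Extension by zero turns the integrals over \<open>U\<close> into integrals over
    the whole space; the approximating functions and their gradients vanish off \<open>U\<close>
    already.\<close>
  define u' where "u' x = indicator U x *\<^sub>R u x" for x
  define H where "H x = indicator U x *\<^sub>R G' x" for x
  have m1: "u' \<in> borel_measurable lebesgue" "H \<in> borel_measurable lebesgue"
    using u G'(2) by (auto simp: in_Lp_def set_borel_measurable_def u'_def[abs_def] H_def[abs_def])
  have c\<phi>: "continuous_on UNIV (\<phi> n)" for n
    using \<phi>[of n] by (auto simp: Cinfc_def smooth_on_def dest: spec[of _ 0])
  have m2: "\<phi> n \<in> borel_measurable lebesgue" "grad (\<phi> n) \<in> borel_measurable lebesgue" for n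
    by (intro measurable_completion; simp add: borel_measurable_continuous_onI c\<phi> Ck_on_1_gradient(2)[OF C1])+
  have mw: "Hardy_weight K D p \<in> borel_measurable lebesgue"
    by (intro measurable_completion) simp
  have w: "Hardy_weight K D p x \<ge> 0" for x by (simp add: Hardy_weight_def)
  have l0: "(\<lambda>n. \<integral>\<^sup>+x. ennreal (norm (\<phi> n x - u' x) powr p) \<partial>lebesgue) \<longlonglongrightarrow> 0"
  proof -
    have "(\<integral>\<^sup>+x. ennreal (norm (\<phi> n x - u' x) powr p) \<partial>lebesgue)
        = (\<integral>\<^sup>+x\<in>U. ennreal (norm (\<phi> n x - u x) powr p) \<partial>lebesgue)" for n
      using \<phi>0 by (intro nn_integral_cong) (auto simp: u'_def indicator_def)
    then show ?thesis using lim0 by simp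
  qed
  have l1: "(\<lambda>n. \<integral>\<^sup>+x. ennreal (norm (grad (\<phi> n) x - H x) powr p) \<partial>lebesgue) \<longlonglongrightarrow> 0"
  proof -
    have "(\<integral>\<^sup>+x. ennreal (norm (grad (\<phi> n) x - H x) powr p) \<partial>lebesgue)
        = (\<integral>\<^sup>+x\<in>U. ennreal (norm (grad (\<phi> n) x - G' x) powr p) \<partial>lebesgue)" for n
      using g\<phi>0 by (intro nn_integral_cong) (auto simp: H_def indicator_def)
    then show ?thesis using lim1 by simp
  qed
  have A: "A_fun \<Omega> K (m + 2) \<psi> \<ge> 0" if "\<psi> \<in> C1c (\<Omega> - K)" "\<And>x. \<psi> x \<ge> 0" for \<psi>
    using assms(8)[OF that] by (simp add: k)
  have "ennreal (((p - 1) / p) powr p) * (\<integral>\<^sup>+x. ennreal (norm (u' x) powr p * Hardy_weight K D p x) \<partial>lebesgue)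
      \<le> (\<integral>\<^sup>+x. ennreal (norm (H x) powr p) \<partial>lebesgue)"
    by (rule weighted_inequality_Lp_limit[OF m1 mw m2 w p(2) _ _ l0 l1])
      (use Hardy_C1c[OF K assms(1) A D _ p(1)] \<phi>C in \<open>auto simp: U_def\<close>)
  \<comment> \<open>Only an inequality: on \<open>\<Omega> \<inter> K\<close> the function
    \<open>H\<close> is 0, while the values of \<open>G\<close> there are unrestricted and count on
    the right.\<close>
  also have "\<dots> \<le> (\<integral>\<^sup>+x\<in>\<Omega>. ennreal (norm (G x) powr p) \<partial>lebesgue)"
  proof (rule nn_integral_mono_AE)
    have "AE x in lebesgue. x \<in> U \<longrightarrow> G x = G' x"
      using weak_gradient_unique[OF U _ G'(1)] assms(11) by (simp add: U_def)
    then show "AE x in lebesgue. ennreal (norm (H x) powr p) \<le> ennreal (norm (G x) powr p) * indicator \<Omega> x"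
      by eventually_elim (auto simp: H_def U_def indicator_def)
  qed
  \<comment> \<open>On \<open>\<Omega> \<inter> K\<close> the denominator \<open>0 powr p\<close> is
    0, so the quotient is 0 and integrating over \<Omega> or over \<open>U\<close> gives the same
    value.\<close>
  also have "(\<integral>\<^sup>+x. ennreal (norm (u' x) powr p * Hardy_weight K D p x) \<partial>lebesgue)
      = (\<integral>\<^sup>+x\<in>\<Omega>. ennreal (\<bar>u x\<bar> powr p / infdist x K powr p * X (infdist x K / D) powr p) \<partial>lebesgue)"
    by (intro nn_integral_cong) (auto simp: u'_def U_def Hardy_weight_def indicator_def)
  finally show ?thesis .
qed

end
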